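(* Let $q\in\mathbb C$ with $0<|q|<1$, let $x=\cos\theta\in[-1,1]$ ($\theta\in[0,\pi]$), let $\beta,\gamma\in(-1,1)\setminus\{0\}$, and let $t\in\mathbb C$ with $|t|<1-\beta^2$. Then $$(te^{-i\theta};q)_\infty\;{}_2\phi_1\!\left(\beta,\beta e^{2i\theta};\beta^2;q,te^{-i\theta}\right)=\sum_{n=0}^\infty\frac{(\beta;q)_n\,q^{\binom n2}(-\beta t)^n}{(\gamma,\beta^2;q)_n}\,C_n(x;\gamma|q)\;{}_2\phi_5\!\left(\beta\gamma^{-1},\beta q^n;\ \gamma q^{n+1},\pm\beta q^{n/2},\pm\beta q^{(n+1)/2};\ q,\gamma(\beta t)^2q^{2n+1}\right).$$
   Context: Notation: $(a;q)_0=1$, $(a;q)_n=\prod_{j=0}^{n-1}(1-aq^j)$, $(a;q)_\infty=\prod_{j\ge0}(1-aq^j)$, $(a_1,\dots,a_r;q)_n=\prod_i(a_i;q)_n$ (also for $n=\infty$). In a list of parameters, $\pm a$ stands for the two entries $a,-a$. A square root $q^{1/2}$ is fixed and $q^{m/2}=(q^{1/2})^m$. The basic hypergeometric series, with upper parameters listed before the first semicolon and lower parameters before the second, is $${}_r\phi_s(a_1,\dots,a_r;b_1,\dots,b_s;q,z)=\sum_{k=0}^\infty\frac{(a_1,\dots,a_r;q)_k}{(q,b_1,\dots,b_s;q)_k}\left((-1)^kq^{\binom k2}\right)^{1+s-r}z^k.$$ The continuous $q$-ultraspherical/Rogers polynomials are, for $x=\cos\theta$, $$C_n(x;\beta|q)=\frac{(\beta;q)_n}{(q;q)_n}e^{in\theta}\,{}_2\phi_1\!\left(q^{-n},\beta;\beta^{-1}q^{1-n};q,q\beta^{-1}e^{-2i\theta}\right).$$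 *)

theory Defs
  imports "HOL-Analysis.Analysis"
begin

definition qpoch :: "complex \<Rightarrow> complex \<Rightarrow> nat \<Rightarrow> complex" where
  "qpoch a q n = (\<Prod>j<n. 1 - a * q ^ j)"

definition qpoch_inf :: "complex \<Rightarrow> complex \<Rightarrow> complex" where
  "qpoch_inf a q = (\<Prod>j. 1 - a * q ^ j)"

definition qpochs :: "complex list \<Rightarrow> complex \<Rightarrow> nat \<Rightarrow> complex" where
  "qpochs as q n = (\<Prod>a\<leftarrow>as. qpoch a q n)"

text \<open>The upper parameters are \<open>as\<close> (r of them), the lower ones \<open>bs\<close> (s of them). The exponent
  1 + s - r may be negative, hence an integer power. In a terminating series a lower parameter may
  make the denominator vanish beyond the last nonzero term; such terms have numerator 0 and are 0
  because division by 0 gives 0.\<close>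

definition qhyp :: "complex list \<Rightarrow> complex list \<Rightarrow> complex \<Rightarrow> complex \<Rightarrow> complex" where
  "qhyp as bs q z =
     (\<Sum>k. qpochs as q k / qpochs (q # bs) q k
           * ((-1) ^ k * q ^ (k choose 2)) powi (1 + int (length bs) - int (length as)) * z ^ k)"

text \<open>The continuous q-ultraspherical polynomial, as a function of x in [-1, 1]: the angle is
  \<open>\<theta> = arccos x\<close>, the one in \<open>[0, \<pi>]\<close> with \<open>x = cos \<theta>\<close>.\<close>

definition rogers :: "nat \<Rightarrow> real \<Rightarrow> complex \<Rightarrow> complex \<Rightarrow> complex" where
  "rogers n x \<beta> q =
     (let \<theta> = complex_of_real (arccos x) in
        qpoch \<beta> q n / qpoch q q n * exp (\<i> * of_nat n * \<theta>)
        * qhyp [q powi (- int n), \<beta>] [inverse \<beta> * q powi (1 - int n)] q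
               (q * inverse \<beta> * exp (- 2 * \<i> * \<theta>)))"

end

theory Submission
  imports Defs "HOL-Computational_Algebra.Formal_Power_Series"
begin

text \<open>Write \<open>R_n(\<beta>)\<close> for the Rogers polynomial of degree \<open>n\<close> with parameter \<open>\<beta>\<close>. The expansion
results from two classical facts. The first is the generating function
  \<open>(t/z;q)_\<infinity> 2\<phi>1(\<beta>, \<beta> z^2; \<beta>^2; q, t/z) = \<Sum>n. (-\<beta> t)^n q^(n choose 2) / (\<beta>^2;q)_n R_n(\<beta>)\<close>
with \<open>z = exp (i \<theta>)\<close>, which is the asserted expansion for \<open>\<gamma> = \<beta>\<close>
(\<open>rogers_generating_function\<close>). The second is Rogers' connection formula, which writes \<open>R_n(\<beta>)\<close>
as a linear combination of the \<open>R_(n-2k)(\<gamma>)\<close> with explicit coefficients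
(\<open>rogers_connection\<close>). Inserting the second into the first gives a double series over \<open>n\<close> and
\<open>k\<close>. Its terms are of size at most \<open>A^n |q|^(n choose 2)\<close> for some \<open>A\<close>, so it may be summed in the
order of \<open>m = n - 2k\<close> instead, and for fixed \<open>m\<close> the sum over \<open>k\<close> is the \<open>2\<phi>5\<close>
(\<open>rogers_expansion\<close>).

The generating function is a Cauchy product with Euler's series for \<open>(t/z;q)_\<infinity>\<close>: the coefficients
are expanded by the q-binomial theorem and evaluated by the q-Chu--Vandermonde sum
(\<open>euler_product_coeff\<close>). The connection formula follows by induction from the three-term recurrence
of the Rogers polynomials, which is read off from the q-difference equation of their ordinary
generating function (\<open>rogers_sum_recurrence\<close>); what remains is a polynomial identity
(\<open>connection_coeff_recurrence\<close>).\<close>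

section \<open>Shifted factorials and finite q-sums\<close>

lemma qpoch_0 [simp]: "qpoch a q 0 = 1" by (simp add: qpoch_def)
lemma qpoch_Suc: "qpoch a q (Suc n) = qpoch a q n * (1 - a * q ^ n)" by (simp add: qpoch_def)
lemma qpoch_add: "qpoch a q (m + n) = qpoch a q m * qpoch (a * q ^ m) q n"
  by (induction n) (simp_all add: qpoch_Suc power_add mult_ac)
lemma qpoch_Suc_left: "qpoch a q (Suc n) = (1 - a) * qpoch (a * q) q n"
  using qpoch_add[of a q 1 n] by (simp add: qpoch_Suc)

text \<open>The moduli of the quantities \<open>a * q ^ j\<close> stay below 1; this is why no
denominator vanishes.\<close>

lemma qpoch_nz:
  assumes "norm q \<le> 1" "norm a < 1"
  shows "qpoch a q n \<noteq> 0"
proof -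
  have "a * q ^ j \<noteq> 1" for j
  proof
    assume "a * q ^ j = 1"
    then have "norm a * norm q ^ j = 1" by (metis norm_mult norm_one norm_power)
    moreover have "norm a * norm q ^ j \<le> norm a * 1"
      by (intro mult_left_mono power_le_one) (use assms in auto)
    ultimately show False using assms by linarith
  qed
  then show ?thesis by (auto simp: qpoch_def)
qed

lemma choose2_Suc: "Suc n choose 2 = (n choose 2) + n"
  by (simp add: numeral_2_eq_2)

lemma choose2_add: "(m + n) choose 2 = (m choose 2) + (n choose 2) + m * n"
  by (induction n) (simp_all add: choose2_Suc)

text \<open>The q-Pascal rule, summed against an arbitrary \<open>f\<close>. It comes from
\<open>1 - q^(m+1) = (1 - q^k) + q^k (1 - q^(m+1-k))\<close>: each of the two pieces cancels the last factor
of one of the two q-factorials in the denominator, and vanishes at the end of the summation range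
where that q-factorial is empty. In this form it turns sums of length \<open>m + 1\<close> into sums of length
\<open>m\<close> and so proves both classical summations below by induction.\<close>

lemma q_pascal_sum:
  fixes f :: "nat \<Rightarrow> complex"
  assumes "norm q < 1"
  shows "(\<Sum>k\<le>Suc m. f k / (qpoch q q k * qpoch q q (Suc m - k))) =
         (\<Sum>k\<le>m. (f (Suc k) + q ^ k * f k) / (qpoch q q k * qpoch q q (m - k))) / (1 - q ^ Suc m)"
proof -
  note nz = qpoch_nz[OF less_imp_le[OF assms] assms]
  define u where "u k = 1 / qpoch q q k" for k
  have u: "(1 - q ^ Suc k) * u (Suc k) = u k" for k
    using nz[of "Suc k"] by (simp add: u_def qpoch_Suc)
  have "q ^ Suc m \<noteq> 1"
    using nz[of "Suc m"] by (auto simp: qpoch_Suc)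
  have "(1 - q ^ Suc m) * (\<Sum>k\<le>Suc m. f k * u k * u (Suc m - k)) =
        (\<Sum>k\<le>Suc m. (1 - q ^ k) * (f k * u k * u (Suc m - k))) +
        (\<Sum>k\<le>Suc m. q ^ k * (1 - q ^ (Suc m - k)) * (f k * u k * u (Suc m - k)))"
    unfolding sum_distrib_left sum.distrib[symmetric]
    by (intro sum.cong) (auto simp: algebra_simps simp flip: power_add)
  also have "(\<Sum>k\<le>Suc m. (1 - q ^ k) * (f k * u k * u (Suc m - k))) =
             (\<Sum>k\<le>m. f (Suc k) * ((1 - q ^ Suc k) * u (Suc k)) * u (m - k))"
    by (subst sum.atMost_Suc_shift) (simp add: mult_ac)
  also have "\<dots> = (\<Sum>k\<le>m. f (Suc k) * u k * u (m - k))"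
    unfolding u ..
  also have "(\<Sum>k\<le>Suc m. q ^ k * (1 - q ^ (Suc m - k)) * (f k * u k * u (Suc m - k))) =
             (\<Sum>k\<le>m. q ^ k * f k * u k * ((1 - q ^ Suc (m - k)) * u (Suc (m - k))))"
    by (simp add: Suc_diff_le mult_ac)
  also have "\<dots> = (\<Sum>k\<le>m. q ^ k * f k * u k * u (m - k))"
    unfolding u ..
  finally show ?thesis
    using \<open>q ^ Suc m \<noteq> 1\<close>
    by (simp add: u_def field_simps sum.distrib[symmetric] add_divide_distrib)
qed

lemma q_binomial:
  assumes "norm q < 1"
  shows "(\<Sum>k\<le>m. (- x) ^ k * q ^ (k choose 2) / (qpoch q q k * qpoch q q (m - k)))
         = qpoch x q m / qpoch q q m"
proof (induction m arbitrary: x)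
  case (Suc m)
  have "(- x) ^ Suc k * q ^ (Suc k choose 2) + q ^ k * ((- x) ^ k * q ^ (k choose 2))
        = (1 - x) * ((- (x * q)) ^ k * q ^ (k choose 2))" for k
  proof -
    have "(- (x * q)) ^ k = (- x) ^ k * q ^ k" by (simp flip: power_mult_distrib)
    then show ?thesis by (simp add: choose2_Suc power_add algebra_simps)
  qed
  then have "(\<Sum>k\<le>Suc m. (- x) ^ k * q ^ (k choose 2) / (qpoch q q k * qpoch q q (Suc m - k)))
      = (1 - x) * (qpoch (x * q) q m / qpoch q q m) / (1 - q ^ Suc m)"
    unfolding q_pascal_sum[OF assms] Suc.IH[symmetric] sum_distrib_left
    by (simp only: times_divide_eq_right)
  then show ?case
    by (simp add: qpoch_Suc[of q] qpoch_Suc_left[of x])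
qed (simp add: numeral_2_eq_2)

text \<open>The q-Chu--Vandermonde sum, with the product \<open>(c/b;q)_N b^N\<close> written without division by \<open>b\<close>.
The two terms of the q-Pascal rule give the sum of length \<open>N\<close> for \<open>(bq, cq)\<close> and for \<open>(b, c)\<close>,
and the closed forms combine because \<open>(1 - b) - (1 - c q^N) = - (b - c q^N)\<close>.\<close>

lemma q_chu_vandermonde:
  assumes "norm q < 1" "norm c < 1"
  shows "(\<Sum>l\<le>N. (-1) ^ (N - l) * q ^ ((N - l) choose 2) * qpoch b q l / qpoch c q l
             / (qpoch q q l * qpoch q q (N - l)))
         = (-1) ^ N * q ^ (N choose 2) * (\<Prod>i<N. b - c * q ^ i) / (qpoch c q N * qpoch q q N)"
  using assms(2)
proof (induction N arbitrary: b c)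
  case (Suc N)
  note c = \<open>norm c < 1\<close>
  have cq: "norm (c * q) < 1"
    using c assms(1) mult_strict_mono[of "norm c" 1 "norm q" 1] by (simp add: norm_mult)
  have nz: "qpoch c q n \<noteq> 0" for n
    using qpoch_nz c assms(1) by auto
  have cN: "1 - c * q ^ N \<noteq> 0"
    using nz[of "Suc N"] by (simp add: qpoch_Suc)
  let ?f = "\<lambda>l. (-1) ^ (Suc N - l) * q ^ ((Suc N - l) choose 2) * qpoch b q l / qpoch c q l"
  let ?P = "\<Prod>i<N. b - c * q ^ i"
  have f: "?f (Suc l) + q ^ l * ?f l =
      (1 - b) / (1 - c) * ((-1) ^ (N - l) * q ^ ((N - l) choose 2) * qpoch (b * q) q l / qpoch (c * q) q l)
      - q ^ N * ((-1) ^ (N - l) * q ^ ((N - l) choose 2) * qpoch b q l / qpoch c q l)" if lN: "l \<le> N" for l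
  proof -
    obtain j where "N = l + j" using le_Suc_ex[OF lN] by blast
    then show ?thesis
      by (simp add: Suc_diff_le choose2_Suc power_add qpoch_Suc_left[of b] qpoch_Suc_left[of c] mult_ac)
  qed
  have P: "(\<Prod>i<N. b * q - c * q * q ^ i) = q ^ N * ?P"
  proof -
    have "(\<Prod>i<N. b * q - c * q * q ^ i) = (\<Prod>i<N. q * (b - c * q ^ i))"
      by (simp add: algebra_simps)
    then show ?thesis by (simp add: prod.distrib)
  qed
  have E1: "qpoch c q N * (1 - c * q ^ N) = (1 - c) * qpoch (c * q) q N"
    by (metis qpoch_Suc qpoch_Suc_left)
  have "(\<Sum>l\<le>Suc N. ?f l / (qpoch q q l * qpoch q q (Suc N - l))) =
     ((1 - b) / (1 - c) * ((-1) ^ N * q ^ (N choose 2) * (q ^ N * ?P) / (qpoch (c * q) q N * qpoch q q N))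
       - q ^ N * ((-1) ^ N * q ^ (N choose 2) * ?P / (qpoch c q N * qpoch q q N))) / (1 - q ^ Suc N)"
    unfolding q_pascal_sum[OF assms(1)] P[symmetric] Suc.IH[OF c, symmetric]
      Suc.IH[OF cq, symmetric] sum_distrib_left sum_subtractf[symmetric]
    by (intro arg_cong2[where f = "(/)"] sum.cong refl) (subst f, simp, simp add: diff_divide_distrib)
  also have "\<dots> = (-1) ^ N * q ^ (N choose 2) * q ^ N * ?P *
      ((1 - b) / ((1 - c) * qpoch (c * q) q N) - 1 / qpoch c q N) / (qpoch q q N * (1 - q ^ Suc N))"
  proof -
    have "(x / y * (e * g * (r * p) / (u * v)) - r * (e * g * p / (w * v))) / d
          = e * g * r * p * (x / (y * u) - 1 / w) / (v * d)" for x y e g r p u v w d :: complex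
      by (simp add: divide_inverse algebra_simps)
    then show ?thesis .
  qed
  also have "(1 - b) / ((1 - c) * qpoch (c * q) q N) - 1 / qpoch c q N
     = - (b - c * q ^ N) / (qpoch c q N * (1 - c * q ^ N))"
    unfolding E1[symmetric] using nz cN by (simp add: field_simps)
  also have "(-1) ^ N * q ^ (N choose 2) * q ^ N * ?P *
      (- (b - c * q ^ N) / (qpoch c q N * (1 - c * q ^ N))) / (qpoch q q N * (1 - q ^ Suc N))
    = (-1) ^ Suc N * q ^ (Suc N choose 2) * (\<Prod>i<Suc N. b - c * q ^ i) / (qpoch c q (Suc N) * qpoch q q (Suc N))"
    by (simp add: qpoch_Suc choose2_Suc power_add mult_ac del: minus_diff_eq)
  finally show ?case .
qed (simp add: numeral_2_eq_2)

text \<open>The coefficient identity behind the generating function: the left side is the coefficient of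
\<open>z^n\<close> in the product of Euler's series for \<open>(z;q)_\<infinity>\<close> with a \<open>2\<phi>1\<close>. Expanding
\<open>(a;q)_m\<close> in powers of \<open>a\<close> by the q-binomial theorem, the coefficient of each power of \<open>a\<close> is a
q-Chu--Vandermonde sum.\<close>

lemma euler_product_coeff:
  assumes "norm q < 1" "norm c < 1"
  shows "(\<Sum>j\<le>n. ((-1) ^ j * q ^ (j choose 2) / qpoch q q j) *
            (qpoch a q (n - j) * qpoch b q (n - j) / (qpoch q q (n - j) * qpoch c q (n - j))))
       = (-1) ^ n * q ^ (n choose 2) / qpoch c q n *
         (\<Sum>k\<le>n. a ^ k * qpoch b q k * (\<Prod>i<n-k. b - c * q ^ i) / (qpoch q q k * qpoch q q (n - k)))"
proof -
  have nz: "qpoch c q n \<noteq> 0" "qpoch q q n \<noteq> 0" "norm (c * q ^ n) < 1" for n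
  proof -
    show "norm (c * q ^ n) < 1"
      using assms mult_left_mono[of "norm q ^ n" 1 "norm c"]
      by (simp add: norm_mult norm_power power_le_one)
  qed (use qpoch_nz assms in auto)
  let ?e = "\<lambda>j. (-1) ^ j * q ^ (j choose 2) / qpoch q q j"
  let ?g = "\<lambda>m k. ?e (n - m) * qpoch b q m / qpoch c q m * ((- a) ^ k * q ^ (k choose 2) / (qpoch q q k * qpoch q q (m - k)))"
  have "(\<Sum>j\<le>n. ?e j * (qpoch a q (n - j) * qpoch b q (n - j) / (qpoch q q (n - j) * qpoch c q (n - j))))
      = (\<Sum>m\<le>n. ?e (n - m) * (qpoch a q m * qpoch b q m / (qpoch q q m * qpoch c q m)))"
    by (subst sum.nat_diff_reindex[symmetric, of _ "Suc n", unfolded lessThan_Suc_atMost]) simp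
  also have "\<dots> = (\<Sum>m\<le>n. ?e (n - m) * qpoch b q m / qpoch c q m * (qpoch a q m / qpoch q q m))"
    by (simp add: mult_ac)
  \<comment> \<open>expand \<open>qpoch a q m\<close> in powers of \<open>a\<close>\<close>
  also have "\<dots> = (\<Sum>m\<le>n. \<Sum>k\<le>m. ?g m k)"
    unfolding q_binomial[OF assms(1), symmetric] sum_distrib_left ..
  also have "\<dots> = (\<Sum>k\<le>n. \<Sum>m\<in>{k..n}. ?g m k)"
    unfolding sum.Sigma[OF finite_atMost ballI[OF finite_atMost]] sum.Sigma[OF finite_atMost ballI[OF finite_atLeastAtMost]]
    by (rule sum.reindex_bij_witness[where i = "\<lambda>(m,k). (k,m)" and j = "\<lambda>(m,k). (k,m)"]) auto
  also have "\<dots> = (\<Sum>k\<le>n. (-1) ^ n * q ^ (n choose 2) / qpoch c q n *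
         (a ^ k * qpoch b q k * (\<Prod>i<n-k. b - c * q ^ i) / (qpoch q q k * qpoch q q (n - k))))"
  proof (intro sum.cong refl)
    fix k assume "k \<in> {..n}"
    then obtain N where n: "n = N + k" by (metis atMost_iff le_iff_add add.commute)
    have "(\<Sum>m\<in>{k..n}. ?g m k) = (\<Sum>l\<le>N. ?g (l + k) k)"
      using sum.shift_bounds_cl_nat_ivl[of "\<lambda>m. ?g m k" 0 k N] by (simp add: n atLeast0AtMost)
    also have "\<dots> = (- a) ^ k * q ^ (k choose 2) * qpoch b q k / (qpoch q q k * qpoch c q k) *
       (\<Sum>l\<le>N. (-1) ^ (N - l) * q ^ ((N - l) choose 2) * qpoch (b * q ^ k) q l / qpoch (c * q ^ k) q l
             / (qpoch q q l * qpoch q q (N - l)))"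
      unfolding sum_distrib_left
    proof (intro sum.cong refl)
      fix l
      have "qpoch b q (l + k) = qpoch b q k * qpoch (b * q ^ k) q l"
           "qpoch c q (l + k) = qpoch c q k * qpoch (c * q ^ k) q l"
        by (metis add.commute qpoch_add)+
      then show "?g (l + k) k = (- a) ^ k * q ^ (k choose 2) * qpoch b q k / (qpoch q q k * qpoch c q k) *
         ((-1) ^ (N - l) * q ^ ((N - l) choose 2) * qpoch (b * q ^ k) q l / qpoch (c * q ^ k) q l
             / (qpoch q q l * qpoch q q (N - l)))"
        by (simp add: n mult_ac)
    qed
    also have "\<dots> = (- a) ^ k * q ^ (k choose 2) * qpoch b q k / (qpoch q q k * qpoch c q k) *
      ((-1) ^ N * q ^ (N choose 2) * (\<Prod>i<N. b * q ^ k - c * q ^ k * q ^ i) / (qpoch (c * q ^ k) q N * qpoch q q N))"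
      by (subst q_chu_vandermonde[OF assms(1) nz(3)]) simp
    also have "(\<Prod>i<N. b * q ^ k - c * q ^ k * q ^ i) = q ^ (N * k) * (\<Prod>i<N. b - c * q ^ i)"
    proof -
      have "(\<Prod>i<N. b * q ^ k - c * q ^ k * q ^ i) = (\<Prod>i<N. q ^ k * (b - c * q ^ i))"
        by (simp add: algebra_simps)
      then show ?thesis by (simp add: prod.distrib power_mult[symmetric] mult.commute)
    qed
    also have "(- a) ^ k * q ^ (k choose 2) * qpoch b q k / (qpoch q q k * qpoch c q k) *
      ((-1) ^ N * q ^ (N choose 2) * (q ^ (N * k) * (\<Prod>i<N. b - c * q ^ i)) / (qpoch (c * q ^ k) q N * qpoch q q N))
      = (-1) ^ n * q ^ (n choose 2) / qpoch c q n *
         (a ^ k * qpoch b q k * (\<Prod>i<n-k. b - c * q ^ i) / (qpoch q q k * qpoch q q (n - k)))"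
    proof -
      have "qpoch c q n = qpoch c q k * qpoch (c * q ^ k) q N"
        unfolding n by (metis add.commute qpoch_add)
      then show ?thesis
        by (simp add: n choose2_add power_add power_minus[of a] mult_ac)
    qed
    finally show "(\<Sum>m\<in>{k..n}. ?g m k) = \<dots>" .
  qed
  finally show ?thesis by (simp only: sum_distrib_left)
qed

section \<open>Euler's series and products with a 2\<phi>1\<close>

lemma summable_norm_ratio:
  fixes f :: "nat \<Rightarrow> 'a :: real_normed_field"
  assumes step: "\<And>n. f (Suc n) = g n * f n" and lim: "g \<longlonglongrightarrow> L" and L: "norm L < 1"
  shows "summable (\<lambda>n. norm (f n))"
proof -
  obtain c where c: "norm L < c" "c < 1" using L dense by blast
  have "eventually (\<lambda>n. norm (g n) < c) sequentially"
    using tendsto_norm[OF lim] c(1) by (rule order_tendstoD)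
  then obtain N where N: "\<And>n. n \<ge> N \<Longrightarrow> norm (g n) < c"
    by (auto simp: eventually_sequentially)
  show ?thesis
  proof (rule summable_ratio_test[OF c(2)])
    fix n assume "n \<ge> N"
    then show "norm (norm (f (Suc n))) \<le> c * norm (norm (f n))"
      using N[of n] by (simp add: step norm_mult mult_right_mono)
  qed
qed

text \<open>The factor \<open>r ^ (n choose 2)\<close> beats every geometric growth. This is why crude exponential bounds on
all other factors suffice later for absolute convergence of a double series.\<close>

lemma summable_gaussian:
  fixes A r :: real
  assumes "0 \<le> r" "r < 1"
  shows "summable (\<lambda>n. norm (A ^ n * r ^ (n choose 2)))"
proof (rule summable_norm_ratio)
  show "A ^ Suc n * r ^ (Suc n choose 2) = (A * r ^ n) * (A ^ n * r ^ (n choose 2))" for n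
    by (simp add: choose2_Suc power_add)
  show "(\<lambda>n. A * r ^ n) \<longlonglongrightarrow> A * 0"
    by (intro tendsto_intros LIMSEQ_realpow_zero assms)
qed simp

lemma qpoch_LIMSEQ:
  assumes "norm q < 1"
  shows "qpoch a q \<longlonglongrightarrow> qpoch_inf a q"
proof -
  have "summable (\<lambda>i. norm ((1 - a * q ^ i) - 1))"
    using assms by (simp add: norm_mult norm_power summable_mult summable_geometric)
  then have "convergent_prod (\<lambda>i. 1 - a * q ^ i)"
    by (intro abs_convergent_prod_imp_convergent_prod summable_imp_abs_convergent_prod)
  then have "(\<lambda>n. \<Prod>i\<le>n. 1 - a * q ^ i) \<longlonglongrightarrow> qpoch_inf a q"
    unfolding qpoch_inf_def by (rule convergent_prod_LIMSEQ)
  then show ?thesis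
    unfolding qpoch_def [abs_def] LIMSEQ_lessThan_iff_atMost .
qed

lemma q_exponential_summable:
  fixes q z :: complex
  assumes "norm q < 1"
  shows "summable (\<lambda>k. norm ((-1) ^ k * q ^ (k choose 2) / qpoch q q k * z ^ k))"
proof (rule summable_norm_ratio)
  show "(-1) ^ Suc k * q ^ (Suc k choose 2) / qpoch q q (Suc k) * z ^ Suc k =
        - (q ^ k * z / (1 - q * q ^ k)) * ((-1) ^ k * q ^ (k choose 2) / qpoch q q k * z ^ k)" for k
    by (simp add: choose2_Suc power_add qpoch_Suc mult_ac)
  show "(\<lambda>k. - (q ^ k * z / (1 - q * q ^ k))) \<longlonglongrightarrow> - (0 * z / (1 - q * 0))"
    by (intro tendsto_intros LIMSEQ_power_zero assms) simp
qed simp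

text \<open>Euler's expansion of \<open>(z;q)_\<infinity>\<close>. The series \<open>F\<close> satisfies \<open>F z = (1 - z) F (q z)\<close>, hence
\<open>F z = (z;q)_n F (q^n z)\<close>, and continuity of \<open>F\<close> at 0 lets \<open>n\<close> tend to infinity.\<close>

lemma euler_q_exponential:
  fixes q z :: complex
  assumes q: "norm q < 1"
  shows "(\<Sum>k. (-1) ^ k * q ^ (k choose 2) / qpoch q q k * z ^ k) = qpoch_inf z q"
proof -
  define e where "e k = (-1) ^ k * q ^ (k choose 2) / qpoch q q k" for k
  define F where "F = (\<lambda>z. \<Sum>k. e k * z ^ k)"
  have summable: "summable (\<lambda>k. e k * z ^ k)" for z
    unfolding e_def by (rule summable_norm_cancel) (rule q_exponential_summable[OF q])
  have e_Suc: "e (Suc k) - e (Suc k) * q ^ Suc k = - (e k * q ^ k)" for k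
  proof -
    have "1 - q ^ Suc k \<noteq> 0"
      using qpoch_nz[of q q "Suc k"] q by (simp add: qpoch_Suc)
    moreover have "e (Suc k) - e (Suc k) * q ^ Suc k = e (Suc k) * (1 - q ^ Suc k)"
      by (simp add: algebra_simps)
    ultimately show ?thesis
      by (simp add: e_def choose2_Suc qpoch_Suc power_add)
  qed
  have F_step: "F z = (1 - z) * F (z * q)" for z
  proof -
    have "F z - F (z * q) = (\<Sum>k. e k * z ^ k - e k * (z * q) ^ k)"
      unfolding F_def by (rule suminf_diff[OF summable summable])
    also have "\<dots> = (\<Sum>k. e (Suc k) * z ^ Suc k - e (Suc k) * (z * q) ^ Suc k)"
      by (subst suminf_split_head[OF summable_diff[OF summable summable]]) simp
    also have "\<dots> = (\<Sum>k. - z * (e k * (z * q) ^ k))"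
    proof (rule suminf_cong)
      fix k
      have "e (Suc k) * z ^ Suc k - e (Suc k) * (z * q) ^ Suc k
          = z ^ Suc k * (e (Suc k) - e (Suc k) * q ^ Suc k)"
        by (simp add: power_mult_distrib algebra_simps)
      then show "e (Suc k) * z ^ Suc k - e (Suc k) * (z * q) ^ Suc k = - z * (e k * (z * q) ^ k)"
        unfolding e_Suc by (simp add: power_mult_distrib)
    qed
    also have "\<dots> = - z * F (z * q)"
      unfolding F_def by (rule suminf_mult[OF summable])
    finally show ?thesis by (simp add: algebra_simps)
  qed
  have F_iter: "F z = qpoch z q n * F (z * q ^ n)" for n
  proof (induction n)
    case (Suc n)
    then show ?case using F_step[of "z * q ^ n"] by (simp add: qpoch_Suc mult_ac)
  qed simp
  have "isCont F 0"
    unfolding F_def by (rule isCont_powser_converges_everywhere[OF summable])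
  moreover have "(\<lambda>n. z * q ^ n) \<longlonglongrightarrow> z * 0"
    by (intro tendsto_intros LIMSEQ_power_zero q)
  ultimately have "(\<lambda>n. F (z * q ^ n)) \<longlonglongrightarrow> F 0"
    by (intro isCont_tendsto_compose[of 0 F]) auto
  then have "(\<lambda>n. qpoch z q n * F (z * q ^ n)) \<longlonglongrightarrow> qpoch_inf z q * F 0"
    by (intro tendsto_mult qpoch_LIMSEQ q)
  then have "F z = qpoch_inf z q * F 0"
    unfolding F_iter[symmetric] by (simp add: LIMSEQ_const_iff)
  moreover have "F 0 = 1"
    unfolding F_def powser_zero by (simp add: e_def numeral_2_eq_2)
  ultimately show ?thesis by (simp add: F_def e_def)
qed

lemma qhyp_2_1:
  "qhyp [b, a] [c] q z = (\<Sum>k. qpoch a q k * qpoch b q k / (qpoch q q k * qpoch c q k) * z ^ k)"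
  by (simp add: qhyp_def qpochs_def mult_ac)

lemma summable_2_1:
  fixes q z :: complex
  assumes "norm q < 1" "norm z < 1"
  shows "summable (\<lambda>k. norm (qpoch a q k * qpoch b q k / (qpoch q q k * qpoch c q k) * z ^ k))"
proof (rule summable_norm_ratio)
  show "qpoch a q (Suc k) * qpoch b q (Suc k) / (qpoch q q (Suc k) * qpoch c q (Suc k)) * z ^ Suc k =
     (1 - a * q ^ k) * (1 - b * q ^ k) / ((1 - q * q ^ k) * (1 - c * q ^ k)) * z *
     (qpoch a q k * qpoch b q k / (qpoch q q k * qpoch c q k) * z ^ k)" for k
    by (simp add: qpoch_Suc mult_ac)
  show "(\<lambda>k. (1 - a * q ^ k) * (1 - b * q ^ k) / ((1 - q * q ^ k) * (1 - c * q ^ k)) * z)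
     \<longlonglongrightarrow> (1 - a * 0) * (1 - b * 0) / ((1 - q * 0) * (1 - c * 0)) * z"
    by (intro tendsto_intros LIMSEQ_power_zero assms) simp
qed (use assms in simp)

text \<open>Multiplying a \<open>2\<phi>1\<close> by \<open>(z;q)_\<infinity>\<close> gives a power series whose coefficients are, up to
elementary factors, polynomials in \<open>a\<close>; for \<open>c = b^2\<close> they become Rogers polynomials.\<close>

lemma qpoch_inf_times_2_1_sums:
  assumes "norm q < 1" "norm c < 1" "norm z < 1"
  shows "(\<lambda>n. (- z) ^ n * q ^ (n choose 2) / qpoch c q n *
         (\<Sum>k\<le>n. a ^ k * qpoch b q k * (\<Prod>i<n-k. b - c * q ^ i) / (qpoch q q k * qpoch q q (n - k))))
         sums (qpoch_inf z q * qhyp [b, a] [c] q z)"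
proof -
  let ?e = "\<lambda>k. (-1) ^ k * q ^ (k choose 2) / qpoch q q k"
  let ?h = "\<lambda>k. qpoch a q k * qpoch b q k / (qpoch q q k * qpoch c q k)"
  have "(\<lambda>n. \<Sum>j\<le>n. (?e j * z ^ j) * (?h (n - j) * z ^ (n - j))) sums
        (qpoch_inf z q * qhyp [b, a] [c] q z)"
    unfolding qhyp_2_1 euler_q_exponential[OF assms(1), symmetric]
    by (intro Cauchy_product_sums q_exponential_summable summable_2_1 assms)
  moreover have "(\<Sum>j\<le>n. (?e j * z ^ j) * (?h (n - j) * z ^ (n - j))) =
      (- z) ^ n * q ^ (n choose 2) / qpoch c q n *
         (\<Sum>k\<le>n. a ^ k * qpoch b q k * (\<Prod>i<n-k. b - c * q ^ i) / (qpoch q q k * qpoch q q (n - k)))" for n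
  proof -
    have "(\<Sum>j\<le>n. (?e j * z ^ j) * (?h (n - j) * z ^ (n - j))) = z ^ n * (\<Sum>j\<le>n. ?e j * ?h (n - j))"
      unfolding sum_distrib_left
    proof (intro sum.cong refl)
      fix j assume "j \<in> {..n}"
      then have "z ^ n = z ^ j * z ^ (n - j)" by (simp flip: power_add)
      then show "(?e j * z ^ j) * (?h (n - j) * z ^ (n - j)) = z ^ n * (?e j * ?h (n - j))"
        by simp
    qed
    then show ?thesis
      unfolding euler_product_coeff[OF assms(1,2)] by (simp add: power_minus[of z])
  qed
  ultimately show ?thesis by simp
qed

section \<open>Rogers polynomials and their recurrence\<close>

text \<open>The Rogers polynomial at \<open>x = (z + 1/z)/2\<close>, in its form symmetric under \<open>z \<leftrightarrow> 1/z\<close>. Being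
free of negative powers of \<open>q\<close> and of \<open>\<beta>\<close>, it is easier to bound and to generate than the
terminating \<open>2\<phi>1\<close>.\<close>

definition rogers_sum :: "complex \<Rightarrow> complex \<Rightarrow> complex \<Rightarrow> nat \<Rightarrow> complex" where
  "rogers_sum q z \<beta> n = (\<Sum>k\<le>n. (qpoch \<beta> q k / qpoch q q k * z ^ k) *
     (qpoch \<beta> q (n - k) / qpoch q q (n - k) * inverse z ^ (n - k)))"

text \<open>Reversing the factors of \<open>(q^(-n);q)_k\<close> and \<open>(\<beta>^(-1) q^(1-n);q)_k\<close> turns the terminating
hypergeometric series into the symmetric sum.\<close>

lemma rogers_eq_rogers_sum:
  fixes q \<beta> :: complex and \<theta> :: real
  assumes q: "q \<noteq> 0" "norm q < 1" and \<beta>: "\<beta> \<noteq> 0" "norm \<beta> < 1"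
    and \<theta>: "0 \<le> \<theta>" "\<theta> \<le> pi"
  shows "rogers n (cos \<theta>) \<beta> q = rogers_sum q (exp (\<i> * of_real \<theta>)) \<beta> n"
proof -
  define z where "z = exp (\<i> * complex_of_real \<theta>)"
  have nz: "qpoch \<beta> q k \<noteq> 0" "qpoch q q k \<noteq> 0" for k
    using qpoch_nz q \<beta> by auto
  have fac: "1 - \<beta> * q ^ k \<noteq> 0" "1 - q * q ^ k \<noteq> 0" for k
    using nz[of "Suc k"] by (simp_all add: qpoch_Suc)
  have [simp]: "z \<noteq> 0" by (simp add: z_def)
  let ?t = "\<lambda>k. qpoch (q powi (- int n)) q k * qpoch \<beta> q k /
       (qpoch q q k * qpoch (inverse \<beta> * q powi (1 - int n)) q k)"
  have powi: "q powi (- int n) = inverse (q ^ n)" "q powi (1 - int n) = q * inverse (q ^ n)"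
    using q by (simp_all add: power_int_minus power_int_diff divide_inverse)
  have main: "qpoch (q powi (- int n)) q k / qpoch (inverse \<beta> * q powi (1 - int n)) q k * (q * inverse \<beta>) ^ k
     = qpoch q q n * qpoch \<beta> q (n - k) / (qpoch q q (n - k) * qpoch \<beta> q n)" if "k \<le> n" for k
    using that
  proof (induction k)
    case 0
    then show ?case using nz by simp
  next
    case (Suc k)
    define d where "d = n - Suc k"
    have n: "n = Suc (k + d)" using Suc.prems by (simp add: d_def)
    have e1: "1 - q powi (- int n) * q ^ k = - (1 - q * q ^ d) / (q * q ^ d)"
      using q unfolding powi by (simp add: n power_add field_simps)
    have e2: "1 - inverse \<beta> * q powi (1 - int n) * q ^ k = - (1 - \<beta> * q ^ d) / (\<beta> * q ^ d)"
      using q \<beta> unfolding powi by (simp add: n power_add field_simps)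
    have "(1 - q powi (- int n) * q ^ k) / (1 - inverse \<beta> * q powi (1 - int n) * q ^ k) * (q * inverse \<beta>)
        = (1 - q * q ^ d) / (1 - \<beta> * q ^ d)"
      unfolding e1 e2 using q \<beta> fac[of d] by (simp add: divide_simps) (simp add: algebra_simps)
    note ratio = this
    have step: "qpoch (q powi (- int n)) q (Suc k) / qpoch (inverse \<beta> * q powi (1 - int n)) q (Suc k) * (q * inverse \<beta>) ^ Suc k
       = (qpoch (q powi (- int n)) q k / qpoch (inverse \<beta> * q powi (1 - int n)) q k * (q * inverse \<beta>) ^ k) *
         ((1 - q powi (- int n) * q ^ k) / (1 - inverse \<beta> * q powi (1 - int n) * q ^ k) * (q * inverse \<beta>))"
      by (simp add: qpoch_Suc)
    have "n - k = Suc d" "n - Suc k = d" using n by auto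
    then show ?case
      unfolding step ratio Suc.IH[OF Suc_leD[OF Suc.prems]]
      using nz fac[of d] by (simp add: qpoch_Suc)
  qed
  \<comment> \<open>the series terminates, whatever its lower parameter does beyond \<open>n\<close>\<close>
  have "qpoch (q powi (- int n)) q k = 0" if "k > n" for k
  proof -
    have "1 - q powi (- int n) * q ^ n = 0" using q by (simp add: power_int_minus)
    then show ?thesis unfolding qpoch_def using that by (intro prod_zero) auto
  qed
  then have zero: "?t k = 0" if "k \<notin> {..n}" for k
    using that by simp
  have "qhyp [q powi (- int n), \<beta>] [inverse \<beta> * q powi (1 - int n)] q (q * inverse \<beta> * exp (- 2 * \<i> * \<theta>))
      = (\<Sum>k. ?t k * (q * inverse \<beta> * exp (- 2 * \<i> * \<theta>)) ^ k)"
    by (simp add: qhyp_def qpochs_def)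
  also have "\<dots> = (\<Sum>k\<le>n. ?t k * (q * inverse \<beta> * exp (- 2 * \<i> * \<theta>)) ^ k)"
    by (rule suminf_finite) (use zero in auto)
  also have "\<dots> = (\<Sum>k\<le>n. qpoch q q n / qpoch \<beta> q n * (qpoch \<beta> q k / qpoch q q k) *
      (qpoch \<beta> q (n - k) / qpoch q q (n - k)) * (inverse z ^ 2) ^ k)"
  proof (intro sum.cong refl)
    fix k assume "k \<in> {..n}"
    then have "k \<le> n" by simp
    have "exp (- 2 * \<i> * \<theta>) = inverse z ^ 2"
      by (simp add: z_def exp_minus[symmetric] power2_eq_square exp_add[symmetric] mult.assoc)
    then have "?t k * (q * inverse \<beta> * exp (- 2 * \<i> * \<theta>)) ^ k =
       (qpoch (q powi (- int n)) q k / qpoch (inverse \<beta> * q powi (1 - int n)) q k * (q * inverse \<beta>) ^ k) *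
       (qpoch \<beta> q k / qpoch q q k) * (inverse z ^ 2) ^ k"
      by (simp add: power_mult_distrib mult_ac)
    then show "?t k * (q * inverse \<beta> * exp (- 2 * \<i> * \<theta>)) ^ k =
       qpoch q q n / qpoch \<beta> q n * (qpoch \<beta> q k / qpoch q q k) *
      (qpoch \<beta> q (n - k) / qpoch q q (n - k)) * (inverse z ^ 2) ^ k"
      unfolding main[OF \<open>k \<le> n\<close>] by (simp add: mult_ac)
  qed
  finally have series: "qhyp [q powi (- int n), \<beta>] [inverse \<beta> * q powi (1 - int n)] q (q * inverse \<beta> * exp (- 2 * \<i> * \<theta>)) = \<dots>" .
  have angle: "arccos (cos \<theta>) = \<theta>" using \<theta> by (rule arccos_cos)
  have phase: "exp (\<i> * of_nat n * complex_of_real \<theta>) = z ^ n"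
    by (simp add: z_def exp_of_nat_mult[symmetric] mult_ac)
  have "rogers n (cos \<theta>) \<beta> q = qpoch \<beta> q n / qpoch q q n * z ^ n *
     (\<Sum>k\<le>n. qpoch q q n / qpoch \<beta> q n * (qpoch \<beta> q k / qpoch q q k) *
      (qpoch \<beta> q (n - k) / qpoch q q (n - k)) * (inverse z ^ 2) ^ k)"
    unfolding rogers_def Let_def angle phase series ..
  also have "\<dots> = (\<Sum>k\<le>n. (qpoch \<beta> q k / qpoch q q k) * (qpoch \<beta> q (n - k) / qpoch q q (n - k)) *
      (z ^ (n - k) * inverse z ^ k))"
    unfolding sum_distrib_left
  proof (intro sum.cong refl)
    fix k assume "k \<in> {..n}"
    then have "z ^ n = z ^ (n - k) * z ^ k" by (simp flip: power_add)
    then have "z ^ n * (inverse z ^ 2) ^ k = z ^ (n - k) * inverse z ^ k"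
      by (simp add: power_mult[symmetric] power2_eq_square power_mult_distrib field_simps)
    then show "qpoch \<beta> q n / qpoch q q n * z ^ n *
     (qpoch q q n / qpoch \<beta> q n * (qpoch \<beta> q k / qpoch q q k) *
      (qpoch \<beta> q (n - k) / qpoch q q (n - k)) * (inverse z ^ 2) ^ k) =
      (qpoch \<beta> q k / qpoch q q k) * (qpoch \<beta> q (n - k) / qpoch q q (n - k)) *
      (z ^ (n - k) * inverse z ^ k)"
      using nz by (simp add: mult_ac)
  qed
  also have "\<dots> = rogers_sum q z \<beta> n"
    unfolding rogers_sum_def
    by (subst sum.nat_diff_reindex[symmetric, of _ "Suc n", unfolded lessThan_Suc_atMost])
       (simp add: mult_ac)
  finally show ?thesis by (simp add: z_def)
qed

text \<open>The generating function of the Rogers polynomials is \<open>G(zX) G(X/z)\<close> with the q-binomial series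
\<open>G(X) = \<Sum> (\<beta>;q)_k / (q;q)_k X^k\<close>, and \<open>(1 - X) G(X) = (1 - \<beta> X) G(q X)\<close>. Hence the generating
function \<open>P\<close> satisfies \<open>(1 - zX) (1 - X/z) P(X) = (1 - \<beta> z X) (1 - \<beta> X/z) P(q X)\<close>, and
comparing coefficients yields the three-term recurrence together with its start in degree 1.\<close>

lemma rogers_sum_recurrence:
  assumes q: "norm q < 1" and z: "z \<noteq> 0"
  shows "(1 - q ^ (n + 2)) * rogers_sum q z \<beta> (n + 2) =
         (z + inverse z) * (1 - \<beta> * q ^ (n + 1)) * rogers_sum q z \<beta> (n + 1)
         - (1 - \<beta> ^ 2 * q ^ n) * rogers_sum q z \<beta> n"
    and "(1 - q) * rogers_sum q z \<beta> 1 = (z + inverse z) * (1 - \<beta>)"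
proof -
  have nz: "1 - q * q ^ k \<noteq> 0" for k
    using qpoch_nz[of q q "Suc k"] q by (simp add: qpoch_Suc)
  define h where "h k = qpoch \<beta> q k / qpoch q q k" for k
  define G where "G x = Abs_fps (\<lambda>k. h k * x ^ k)" for x
  have G: "(1 - fps_const x * fps_X) * G x = (1 - fps_const (\<beta> * x) * fps_X) * G (q * x)" for x
  proof (rule fps_ext)
    fix n show "fps_nth ((1 - fps_const x * fps_X) * G x) n = fps_nth ((1 - fps_const (\<beta> * x) * fps_X) * G (q * x)) n"
    proof (cases n)
      case (Suc k)
      have "h (Suc k) * (1 - q * q ^ k) = h k * (1 - \<beta> * q ^ k)"
        using nz[of k] by (simp add: h_def qpoch_Suc)
      moreover have "h (Suc k) * x ^ Suc k - x * (h k * x ^ k)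
          = h (Suc k) * (q * x) ^ Suc k - \<beta> * x * (h k * (q * x) ^ k)"
        if "h (Suc k) * (1 - q * q ^ k) = h k * (1 - \<beta> * q ^ k)"
      proof -
        have "h (Suc k) * x ^ Suc k - x * (h k * x ^ k)
            - (h (Suc k) * (q * x) ^ Suc k - \<beta> * x * (h k * (q * x) ^ k))
            = x ^ Suc k * (h (Suc k) * (1 - q * q ^ k) - h k * (1 - \<beta> * q ^ k))"
          by (simp add: power_mult_distrib algebra_simps)
        then show ?thesis using that by simp
      qed
      ultimately show ?thesis
        by (simp add: Suc left_diff_distrib mult.assoc G_def)
    qed (simp add: left_diff_distrib mult.assoc G_def)
  qed
  define P where "P = G z * G (inverse z)"
  have P: "fps_nth P n = rogers_sum q z \<beta> n" for n
    by (simp add: P_def G_def h_def fps_mult_nth rogers_sum_def atLeast0AtMost)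
  have Pq: "fps_nth (G (q * z) * G (q * inverse z)) n = q ^ n * rogers_sum q z \<beta> n" for n
    unfolding fps_mult_nth rogers_sum_def atLeast0AtMost sum_distrib_left
  proof (intro sum.cong refl)
    fix k assume "k \<in> {..n}"
    then have "q ^ n = q ^ k * q ^ (n - k)" by (simp flip: power_add)
    then show "fps_nth (G (q * z)) k * fps_nth (G (q * inverse z)) (n - k) = q ^ n * ((qpoch \<beta> q k / qpoch q q k * z ^ k) *
     (qpoch \<beta> q (n - k) / qpoch q q (n - k) * inverse z ^ (n - k)))"
      by (simp add: G_def h_def power_mult_distrib)
  qed
  let ?y = "z + inverse z"
  have expand: "(1 - u * X) * (1 - v * X) = 1 - (u + v) * X + u * v * X ^ 2" for u v X :: "complex fps"
    by (simp add: algebra_simps power2_eq_square)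
  have q1: "(1 - fps_const z * fps_X) * (1 - fps_const (inverse z) * fps_X) = 1 - fps_const ?y * fps_X + fps_X ^ 2"
    unfolding expand using z by simp
  have q2: "(1 - fps_const (\<beta> * z) * fps_X) * (1 - fps_const (\<beta> * inverse z) * fps_X)
     = 1 - fps_const (\<beta> * ?y) * fps_X + fps_const (\<beta> ^ 2) * fps_X ^ 2"
    unfolding expand using z by (simp add: power2_eq_square distrib_left)
  have "(1 - fps_const ?y * fps_X + fps_X ^ 2) * P
     = ((1 - fps_const z * fps_X) * G z) * ((1 - fps_const (inverse z) * fps_X) * G (inverse z))"
    unfolding q1[symmetric] P_def by (simp add: mult_ac)
  also have "\<dots> = (1 - fps_const (\<beta> * ?y) * fps_X + fps_const (\<beta> ^ 2) * fps_X ^ 2) * (G (q * z) * G (q * inverse z))"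
    unfolding G q2[symmetric] by (simp add: mult_ac)
  finally have eq: "(1 - fps_const ?y * fps_X + fps_X ^ 2) * P = \<dots>" .
  have coeff: "fps_nth ((1 - fps_const a * fps_X + fps_const b * fps_X ^ 2) * F) (n + 2) = fps_nth F (n + 2) - a * fps_nth F (n + 1) + b * fps_nth F n"
     "fps_nth ((1 - fps_const a * fps_X + fps_const b * fps_X ^ 2) * F) 1 = fps_nth F 1 - a * fps_nth F 0"
     for a b :: complex and F n
    by (simp_all add: left_diff_distrib distrib_right fps_X_power_mult_nth mult.assoc)
  have eqn: "fps_nth ((1 - fps_const ?y * fps_X + fps_const 1 * fps_X ^ 2) * P) m =
     fps_nth ((1 - fps_const (\<beta> * ?y) * fps_X + fps_const (\<beta> ^ 2) * fps_X ^ 2) * (G (q * z) * G (q * inverse z))) m" for m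
    using eq by simp
  show "(1 - q ^ (n + 2)) * rogers_sum q z \<beta> (n + 2) =
         (z + inverse z) * (1 - \<beta> * q ^ (n + 1)) * rogers_sum q z \<beta> (n + 1)
         - (1 - \<beta> ^ 2 * q ^ n) * rogers_sum q z \<beta> n"
    using eqn[of "n + 2"] unfolding coeff P Pq by (simp add: algebra_simps)
  have "rogers_sum q z \<beta> 0 = 1" by (simp add: rogers_sum_def)
  then show "(1 - q) * rogers_sum q z \<beta> 1 = (z + inverse z) * (1 - \<beta>)"
    using eqn[of 1] unfolding coeff P Pq by (simp add: algebra_simps)
qed

section \<open>Rogers' connection formula\<close>

text \<open>Rogers' connection coefficient, up to the factor \<open>1 - \<gamma> q^m\<close>, of degree \<open>m = n - 2 k\<close> in degree
\<open>n\<close>, indexed by \<open>s = n - k\<close> and \<open>k\<close>. The product is \<open>\<gamma>^k (\<beta>/\<gamma>;q)_k\<close>. Splitting off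
\<open>1 - \<gamma> q^m\<close> matters because the recurrence with parameter \<open>\<gamma>\<close> expresses \<open>(z + 1/z) (1 - \<gamma> q^m) R_m(\<gamma>)\<close>.\<close>

definition connection_coeff :: "complex \<Rightarrow> complex \<Rightarrow> complex \<Rightarrow> nat \<Rightarrow> nat \<Rightarrow> complex" where
  "connection_coeff q \<beta> \<gamma> s k =
     (\<Prod>j<k. \<gamma> - \<beta> * q ^ j) * qpoch \<beta> q s / (qpoch q q k * qpoch \<gamma> q (s + 1))"

text \<open>What the recurrences of both polynomial families demand of the connection coefficients. Up to
the common factor \<open>connection_coeff q \<beta> \<gamma> s j\<close> it is a rational identity in \<open>S = q^s\<close> and \<open>J = q^j\<close>.
The quotient \<open>q^s / q^j\<close> is \<open>q^m\<close> for a degree \<open>m\<close> that may be negative.\<close>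

lemma connection_coeff_recurrence:
  assumes q: "q \<noteq> 0" "norm q < 1" and \<gamma>: "norm \<gamma> < 1"
  shows "(1 - q ^ (s + j + 2)) * connection_coeff q \<beta> \<gamma> (s + 1) (j + 1) * (1 - \<gamma> * (q ^ s / q ^ j)) =
     (1 - \<beta> * q ^ (s + j + 1)) * (connection_coeff q \<beta> \<gamma> s (j + 1) * (1 - q ^ s / q ^ j)
        + connection_coeff q \<beta> \<gamma> (s + 1) j * (1 - \<gamma> ^ 2 * (q ^ s / q ^ j)))
     - (1 - \<beta> ^ 2 * q ^ (s + j)) * connection_coeff q \<beta> \<gamma> s j * (1 - \<gamma> * (q ^ s / q ^ j))"
proof -
  define S where "S = q ^ s"
  define J where "J = q ^ j"
  define c where "c = connection_coeff q \<beta> \<gamma> s j"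
  have J: "J \<noteq> 0" using q by (simp add: J_def)
  have nz: "1 - q * J \<noteq> 0" "1 - \<gamma> * q * S \<noteq> 0"
    using qpoch_nz[of q q "Suc j"] qpoch_nz[of q \<gamma> "Suc (Suc s)"] q \<gamma>
    by (auto simp: qpoch_Suc J_def S_def mult.assoc)
  define A B P Q where "A = 1 - \<beta> * S" and "B = 1 - \<gamma> * q * S" and "P = \<gamma> - \<beta> * J" and "Q = 1 - q * J"
  have c1: "connection_coeff q \<beta> \<gamma> (s + 1) j = c * A / B"
    and c2: "connection_coeff q \<beta> \<gamma> s (j + 1) = c * P / Q"
    and c3: "connection_coeff q \<beta> \<gamma> (s + 1) (j + 1) = c * A * P / (B * Q)"
    by (simp_all add: connection_coeff_def c_def A_def B_def P_def Q_def qpoch_Suc S_def J_def mult_ac)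
  have BQ: "B \<noteq> 0" "Q \<noteq> 0" using nz by (simp_all add: B_def Q_def)
  have "(1 - q ^ 2 * S * J) * P * A * (J - \<gamma> * S) =
    (1 - \<beta> * q * S * J) * (P * B * (J - S) + A * Q * (J - \<gamma> ^ 2 * S)) - (1 - \<beta> ^ 2 * S * J) * (J - \<gamma> * S) * B * Q"
    unfolding A_def B_def P_def Q_def by algebra
  note poly = this
  have combine: "X * (c * A * P / (B * Q)) * (U / J) = Y * (c * P / Q * (V / J) + c * A / B * (W / J)) - Z * c * (U / J)"
    if "X * P * A * U = Y * (P * B * V + A * Q * W) - Z * U * B * Q" for X Y Z U V W
  proof -
    have "X * (c * A * P / (B * Q)) * (U / J) = c / (B * Q * J) * (X * P * A * U)"
      by (simp add: mult_ac)
    also have "\<dots> = Y * (c * P / Q * (V / J) + c * A / B * (W / J)) - Z * c * (U / J)"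
      unfolding that using BQ J by (simp add: field_simps)
    finally show ?thesis .
  qed
  have powers: "q ^ (s + j + 2) = q ^ 2 * S * J" "q ^ (s + j + 1) = q * S * J" "q ^ (s + j) = S * J"
    by (simp_all add: S_def J_def power_add power2_eq_square)
  have d: "1 - x * (S / J) = (J - x * S) / J" "1 - S / J = (J - S) / J" for x
    using J by (simp_all add: field_simps)
  show ?thesis
    unfolding c1 c2 c3 c_def[symmetric] S_def[symmetric] J_def[symmetric] powers d
    by (rule combine) (use poly in \<open>simp only: mult.assoc\<close>)
qed

text \<open>Extending the polynomials by 0 to negative degrees makes the three-term recurrence hold for all
integer degrees, so that no case distinction on the end of the connection sum is needed.\<close>

definition rogers_ext :: "complex \<Rightarrow> complex \<Rightarrow> complex \<Rightarrow> int \<Rightarrow> complex" where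
  "rogers_ext q z \<beta> m = (if m < 0 then 0 else rogers_sum q z \<beta> (nat m))"

lemma rogers_sum_0 [simp]: "rogers_sum q z \<beta> 0 = 1"
  by (simp add: rogers_sum_def)

lemma rogers_ext_recurrence:
  assumes q: "q \<noteq> 0" "norm q < 1" and z: "z \<noteq> 0"
  shows "(z + inverse z) * ((1 - \<beta> * q powi m) * rogers_ext q z \<beta> m) =
     (1 - q powi (m + 1)) * rogers_ext q z \<beta> (m + 1)
     + (1 - \<beta> ^ 2 * q powi (m - 1)) * rogers_ext q z \<beta> (m - 1)"
proof -
  consider "m < - 1" | "m = - 1" | "m = 0" | n where "m = int (n + 1)"
  proof (cases "m \<le> 0")
    case False
    then have "m = int (nat (m - 1) + 1)" by simp
    then show ?thesis using that by blast
  qed (use that in linarith)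
  then show ?thesis
  proof cases
    case 3
    then show ?thesis
      using rogers_sum_recurrence(2)[OF q(2) z, of \<beta>] by (simp add: rogers_ext_def)
  next
    case 4
    have "m + 1 = int (n + 2)" "m - 1 = int n" "m = int (n + 1)" using 4 by simp_all
    then show ?thesis
      using rogers_sum_recurrence(1)[OF q(2) z, of n \<beta>]
      by (simp only: rogers_ext_def power_int_of_nat nat_int of_nat_less_0_iff if_False) (simp add: mult_ac)
  qed (simp_all add: rogers_ext_def)
qed

text \<open>Rogers' connection formula, by induction on the degree: inserting the formula for two consecutive
degrees into the recurrence with parameter \<open>\<beta>\<close> and applying the one with parameter \<open>\<gamma>\<close> to every summand reduces
the claim to the recurrence of the coefficients. The sum runs over all \<open>k \<le> n\<close>, the terms of
negative degree being 0.\<close>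

lemma rogers_connection_ext:
  assumes q: "q \<noteq> 0" "norm q < 1" and \<gamma>: "norm \<gamma> < 1" and z: "z \<noteq> 0"
  shows "rogers_sum q z \<beta> n = (\<Sum>k\<le>n. connection_coeff q \<beta> \<gamma> (n - k) k *
    ((1 - \<gamma> * q powi (int n - 2 * int k)) * rogers_ext q z \<gamma> (int n - 2 * int k)))"
proof (induction n rule: nat_less_induct)
  case (1 n)
  let ?d = "connection_coeff q \<beta> \<gamma>" and ?R = "rogers_ext q z \<gamma>"
  have nz: "1 - q * q ^ k \<noteq> 0" "1 - \<gamma> * q ^ k \<noteq> 0" for k
    using qpoch_nz[of q q "Suc k"] qpoch_nz[of q \<gamma> "Suc k"] q \<gamma> by (auto simp: qpoch_Suc)
  consider "n = 0" | "n = 1" | m where "n = m + 2"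
    by (metis One_nat_def add_2_eq_Suc' not0_implies_Suc)
  then show ?case
  proof cases
    case 1
    then show ?thesis
      using nz(2)[of 0] by (simp add: connection_coeff_def rogers_ext_def qpoch_Suc)
  next
    case 2
    have R1: "(1 - q) * rogers_sum q z x 1 = (z + inverse z) * (1 - x)" for x
      by (rule rogers_sum_recurrence(2)[OF q(2) z])
    have "1 - q \<noteq> 0" using nz(1)[of 0] by simp
    then have "rogers_sum q z x 1 = (z + inverse z) * (1 - x) / (1 - q)" for x
      using R1[of x] by (simp add: field_simps)
    then show ?thesis
      using nz(2)[of 0] nz(2)[of 1] by (simp add: 2 connection_coeff_def rogers_ext_def qpoch_Suc)
  next
    case (3 m)
    \<comment> \<open>\<open>T k\<close> and \<open>x k\<close> belong to the degree \<open>m + 2 - 2 * k\<close> of the \<open>k\<close>-th summand\<close>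
    define T where "T k = ?R (int m + 2 - 2 * int k)" for k
    define x where "x k = q powi (int m + 2 - 2 * int k)" for k
    have T_zero: "T (m + 2) = 0" by (simp add: T_def rogers_ext_def)
    have x_Suc: "x (Suc j) = q ^ s / q ^ j" if "m = s + j" for s j
      using q by (simp add: x_def that power_int_diff)
    have xm: "q powi (int m + 1 - 2 * int k + 1) = x k" "q powi (int m + 1 - 2 * int k - 1) = x (Suc k)"
             "q powi (int m - 2 * int k) = x (Suc k)" for k
      by (simp_all add: x_def algebra_simps)
    have Tm: "?R (int m + 1 - 2 * int k + 1) = T k" "?R (int m + 1 - 2 * int k - 1) = T (Suc k)"
             "?R (int m - 2 * int k) = T (Suc k)" for k
      by (simp_all add: T_def algebra_simps)
    have IH1: "(z + inverse z) * rogers_sum q z \<beta> (m + 1) =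
        (\<Sum>k\<le>m+1. ?d (m + 1 - k) k * (1 - x k) * T k) + (\<Sum>k\<le>m+1. ?d (m + 1 - k) k * (1 - \<gamma> ^ 2 * x (Suc k)) * T (Suc k))"
    proof -
      have "rogers_sum q z \<beta> (m + 1) = (\<Sum>k\<le>m+1. ?d (m + 1 - k) k *
         ((1 - \<gamma> * q powi (int m + 1 - 2 * int k)) * ?R (int m + 1 - 2 * int k)))"
      proof -
        have lt: "m + 1 < n" and i: "int (m + 1) = int m + 1" using 3 by simp_all
        show ?thesis using 1[rule_format, OF lt] unfolding i .
      qed
      then have "(z + inverse z) * rogers_sum q z \<beta> (m + 1) = (\<Sum>k\<le>m+1. ?d (m + 1 - k) k *
         ((z + inverse z) * ((1 - \<gamma> * q powi (int m + 1 - 2 * int k)) * ?R (int m + 1 - 2 * int k))))"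
        by (simp only: sum_distrib_left mult_ac)
      then show ?thesis
        unfolding rogers_ext_recurrence[OF q z] xm Tm by (simp only: sum.distrib[symmetric] distrib_left mult.assoc)
    qed
    have IH0: "rogers_sum q z \<beta> m = (\<Sum>k\<le>m. ?d (m - k) k * (1 - \<gamma> * x (Suc k)) * T (Suc k))"
      using 1[rule_format, of m] 3 unfolding xm Tm by (simp add: mult.assoc)
    let ?l = "\<lambda>k. (1 - q ^ (m + 2)) * (?d (m + 2 - k) k * (1 - \<gamma> * x k) * T k)"
    let ?b = "1 - \<beta> * q ^ (m + 1)" and ?bb = "1 - \<beta> ^ 2 * q ^ m"
    \<comment> \<open>compare the coefficients of \<open>T k\<close>, at \<open>k = 0\<close> and then at \<open>k = j + 1\<close>\<close>
    have l0: "?l 0 = ?b * (?d (m + 1) 0 * (1 - x 0) * T 0)"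
      using nz(2)[of "Suc (Suc m)"]
      by (simp add: x_def connection_coeff_def qpoch_Suc power_int_add power_add power2_eq_square q mult_ac)
    have lS: "?l (Suc j) = ?b * (?d (m - j) (Suc j) * (1 - x (Suc j)) * T (Suc j)
        + ?d (m + 1 - j) j * (1 - \<gamma> ^ 2 * x (Suc j)) * T (Suc j))
        - ?bb * (?d (m - j) j * (1 - \<gamma> * x (Suc j)) * T (Suc j))" if "j \<le> m" for j
    proof -
      obtain s where m: "m = s + j" using \<open>j \<le> m\<close> by (metis le_iff_add add.commute)
      show ?thesis
        using arg_cong[OF connection_coeff_recurrence[OF q \<gamma>, of s j \<beta>], of "\<lambda>y. y * T (Suc j)"]
        unfolding x_Suc[OF m, symmetric] by (simp add: m algebra_simps)
    qed
    have "(1 - q ^ (m + 2)) * (\<Sum>k\<le>m+2. ?d (m + 2 - k) k * (1 - \<gamma> * x k) * T k) = ?l 0 + (\<Sum>j\<le>m. ?l (Suc j))"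
    proof -
      have "(\<Sum>k\<le>m+2. f k) = f 0 + (\<Sum>j\<le>m. f (Suc j))" if "f (m + 2) = 0" for f :: "nat \<Rightarrow> complex"
        using that sum.atMost_Suc_shift[of f m] by simp
      then show ?thesis
        unfolding sum_distrib_left by this (simp only: T_zero mult_zero_right)
    qed
    also have "\<dots> = ?b * (?d (m + 1) 0 * (1 - x 0) * T 0 + (\<Sum>j\<le>m. ?d (m - j) (Suc j) * (1 - x (Suc j)) * T (Suc j))
        + (\<Sum>j\<le>m. ?d (m + 1 - j) j * (1 - \<gamma> ^ 2 * x (Suc j)) * T (Suc j)))
        - ?bb * (\<Sum>j\<le>m. ?d (m - j) j * (1 - \<gamma> * x (Suc j)) * T (Suc j))"
      unfolding l0 using lS by (simp add: sum.distrib sum_subtractf sum_distrib_left distrib_left)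
    also have "?d (m + 1) 0 * (1 - x 0) * T 0 + (\<Sum>j\<le>m. ?d (m - j) (Suc j) * (1 - x (Suc j)) * T (Suc j))
       = (\<Sum>k\<le>m+1. ?d (m + 1 - k) k * (1 - x k) * T k)"
      by (simp add: sum.atMost_Suc_shift del: sum.atMost_Suc)
    also have "(\<Sum>j\<le>m. ?d (m + 1 - j) j * (1 - \<gamma> ^ 2 * x (Suc j)) * T (Suc j)) =
       (\<Sum>k\<le>m+1. ?d (m + 1 - k) k * (1 - \<gamma> ^ 2 * x (Suc k)) * T (Suc k))"
      using T_zero by simp
    also have "?b * ((\<Sum>k\<le>m+1. ?d (m + 1 - k) k * (1 - x k) * T k) +
       (\<Sum>k\<le>m+1. ?d (m + 1 - k) k * (1 - \<gamma> ^ 2 * x (Suc k)) * T (Suc k)))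
       - ?bb * (\<Sum>j\<le>m. ?d (m - j) j * (1 - \<gamma> * x (Suc j)) * T (Suc j))
       = (1 - q ^ (m + 2)) * rogers_sum q z \<beta> (m + 2)"
      unfolding IH1[symmetric] IH0[symmetric] rogers_sum_recurrence(1)[OF q(2) z] by (simp add: mult_ac)
    finally have "(1 - q ^ (m + 2)) * rogers_sum q z \<beta> (m + 2) =
       (1 - q ^ (m + 2)) * (\<Sum>k\<le>m+2. ?d (m + 2 - k) k * (1 - \<gamma> * x k) * T k)" by (rule sym)
    moreover have "1 - q ^ (m + 2) \<noteq> 0"
      using nz(1)[of "m + 1"] by simp
    ultimately have "rogers_sum q z \<beta> (m + 2) = (\<Sum>k\<le>m+2. ?d (m + 2 - k) k * (1 - \<gamma> * x k) * T k)"
      using mult_left_cancel by blast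
    moreover have "int (m + 2) = int m + 2" by simp
    ultimately show ?thesis
      unfolding 3 x_def T_def mult.assoc by (simp only:)
  qed
qed

lemma rogers_connection:
  assumes q: "q \<noteq> 0" "norm q < 1" and \<gamma>: "norm \<gamma> < 1" and z: "z \<noteq> 0"
  shows "rogers_sum q z \<beta> n = (\<Sum>k\<le>n div 2. connection_coeff q \<beta> \<gamma> (n - k) k *
    ((1 - \<gamma> * q ^ (n - 2 * k)) * rogers_sum q z \<gamma> (n - 2 * k)))"
proof -
  have "rogers_sum q z \<beta> n = (\<Sum>k\<le>n div 2. connection_coeff q \<beta> \<gamma> (n - k) k *
    ((1 - \<gamma> * q powi (int n - 2 * int k)) * rogers_ext q z \<gamma> (int n - 2 * int k)))"
    unfolding rogers_connection_ext[OF assms, of \<beta> n]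
    by (rule sum.mono_neutral_right) (auto simp: rogers_ext_def)
  also have "\<dots> = (\<Sum>k\<le>n div 2. connection_coeff q \<beta> \<gamma> (n - k) k *
    ((1 - \<gamma> * q ^ (n - 2 * k)) * rogers_sum q z \<gamma> (n - 2 * k)))"
  proof (intro sum.cong refl)
    fix k assume "k \<in> {..n div 2}"
    then have "int n - 2 * int k = int (n - 2 * k)" by auto
    then show "connection_coeff q \<beta> \<gamma> (n - k) k *
      ((1 - \<gamma> * q powi (int n - 2 * int k)) * rogers_ext q z \<gamma> (int n - 2 * int k)) =
      connection_coeff q \<beta> \<gamma> (n - k) k *
      ((1 - \<gamma> * q ^ (n - 2 * k)) * rogers_sum q z \<gamma> (n - 2 * k))"
      by (simp only: rogers_ext_def power_int_of_nat nat_int of_nat_less_0_iff if_False)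
  qed
  finally show ?thesis .
qed

section \<open>The 2\<phi>5 series and the double series\<close>

lemma choose2_double: "(2 * k) choose 2 = 4 * (k choose 2) + k"
  by (induction k) (simp_all add: choose2_Suc)

text \<open>The four parameters \<open>\<plusminus>b, \<plusminus>b q^(1/2)\<close> encode a single shifted factorial of twice the length. This
is where the lower parameters of the \<open>2\<phi>5\<close> come from.\<close>

lemma qpoch_base_doubling:
  assumes "p ^ 2 = q"
  shows "qpoch (b ^ 2) q (2 * k) = qpoch b q k * qpoch (- b) q k * qpoch (b * p) q k * qpoch (- (b * p)) q k"
proof (induction k)
  case (Suc k)
  have "(1 - b * x) * (1 + b * x) = 1 - b ^ 2 * (x * x)"
    and "(1 - b * p * x) * (1 + b * p * x) = 1 - b ^ 2 * (q * (x * x))" for x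
    by (simp_all add: algebra_simps power2_eq_square flip: assms)
  from this[of "q ^ k"]
  have "(1 - b * q ^ k) * (1 + b * q ^ k) = 1 - b ^ 2 * q ^ (2 * k)"
    and "(1 - b * p * q ^ k) * (1 + b * p * q ^ k) = 1 - b ^ 2 * q ^ Suc (2 * k)"
    by (simp_all add: mult_2 power_add)
  then show ?case
    using Suc.IH by (simp add: qpoch_Suc mult_ac)
qed simp

text \<open>The summands of the double series: \<open>m\<close> is the degree of the Rogers polynomial in \<open>\<gamma>\<close>, and
\<open>m + 2 * k\<close> is the degree of the polynomial in \<open>\<beta>\<close> from whose connection formula the summand
comes.\<close>

definition expansion_term :: "complex \<Rightarrow> complex \<Rightarrow> complex \<Rightarrow> complex \<Rightarrow> complex \<Rightarrow> nat \<Rightarrow> nat \<Rightarrow> complex" where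
  "expansion_term q t z \<beta> \<gamma> m k =
     (- \<beta> * t) ^ (m + 2 * k) * q ^ ((m + 2 * k) choose 2) / qpoch (\<beta> ^ 2) q (m + 2 * k) *
     (connection_coeff q \<beta> \<gamma> (m + k) k * ((1 - \<gamma> * q ^ m) * rogers_sum q z \<gamma> m))"

text \<open>For fixed \<open>m\<close>, the summand is a constant times the \<open>k\<close>-th term of the \<open>2\<phi>5\<close>. The exponents of
\<open>q\<close> agree because \<open>(m + 2 k choose 2) = (m choose 2) + 4 (k choose 2) + (2 m + 1) k\<close>.\<close>

lemma expansion_term_eq_2phi5_term:
  assumes q: "norm q < 1" and p: "p ^ 2 = q" and \<gamma>: "norm \<gamma> < 1" "\<gamma> \<noteq> 0"
  shows "expansion_term q t z \<beta> \<gamma> m k =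
    (qpoch \<beta> q m * q ^ (m choose 2) * (- \<beta> * t) ^ m / qpochs [\<gamma>, \<beta> ^ 2] q m * rogers_sum q z \<gamma> m) *
    (qpochs [\<beta> * inverse \<gamma>, \<beta> * q ^ m] q k /
     qpochs (q # [\<gamma> * q ^ (m + 1), \<beta> * p ^ m, - (\<beta> * p ^ m), \<beta> * p ^ (m + 1), - (\<beta> * p ^ (m + 1))]) q k *
     ((-1) ^ k * q ^ (k choose 2)) powi
       (1 + int (length [\<gamma> * q ^ (m + 1), \<beta> * p ^ m, - (\<beta> * p ^ m), \<beta> * p ^ (m + 1), - (\<beta> * p ^ (m + 1))])
          - int (length [\<beta> * inverse \<gamma>, \<beta> * q ^ m])) *
     (\<gamma> * (\<beta> * t) ^ 2 * q ^ (2 * m + 1)) ^ k)"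
proof -
  have "1 - \<gamma> * q ^ m \<noteq> 0"
    using qpoch_nz[of q \<gamma> "Suc m"] q \<gamma> by (auto simp: qpoch_Suc)
  moreover have "qpoch \<gamma> q (m + k + 1) = qpoch \<gamma> q m * (1 - \<gamma> * q ^ m) * qpoch (\<gamma> * q ^ (m + 1)) q k"
    using qpoch_add[of \<gamma> q "m + 1" k] by (simp add: qpoch_Suc add_ac)
  moreover have "qpoch \<beta> q (m + k) = qpoch \<beta> q m * qpoch (\<beta> * q ^ m) q k"
    by (rule qpoch_add)
  moreover have "(\<Prod>j<k. \<gamma> - \<beta> * q ^ j) = \<gamma> ^ k * qpoch (\<beta> * inverse \<gamma>) q k"
  proof -
    have "\<gamma> - \<beta> * q ^ j = \<gamma> * (1 - \<beta> * inverse \<gamma> * q ^ j)" for j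
      using \<gamma> by (simp add: field_simps)
    then show ?thesis by (simp add: qpoch_def prod.distrib)
  qed
  ultimately have coeff: "connection_coeff q \<beta> \<gamma> (m + k) k * (1 - \<gamma> * q ^ m) =
      \<gamma> ^ k * qpoch (\<beta> * inverse \<gamma>) q k * qpoch \<beta> q m * qpoch (\<beta> * q ^ m) q k /
      (qpoch q q k * qpoch \<gamma> q m * qpoch (\<gamma> * q ^ (m + 1)) q k)"
    by (simp add: connection_coeff_def mult_ac)
  have "(\<beta> * p ^ m) ^ 2 = \<beta> ^ 2 * q ^ m"
    by (simp add: power_mult_distrib p[symmetric] power_mult[symmetric] mult.commute)
  then have lower: "qpoch (\<beta> ^ 2) q (m + 2 * k) = qpoch (\<beta> ^ 2) q m * (qpoch (\<beta> * p ^ m) q k *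
       qpoch (- (\<beta> * p ^ m)) q k * qpoch (\<beta> * p ^ (m + 1)) q k * qpoch (- (\<beta> * p ^ (m + 1))) q k)"
    using qpoch_base_doubling[OF p, of "\<beta> * p ^ m" k] by (simp add: qpoch_add mult_ac)
  have binom: "(m + 2 * k) choose 2 = (m choose 2) + (4 * (k choose 2) + (2 * m + 1) * k)"
    unfolding choose2_add choose2_double by (simp add: algebra_simps)
  have qpow: "q ^ ((m + 2 * k) choose 2) = q ^ (m choose 2) * ((q ^ (k choose 2)) ^ 4 * (q ^ (2 * m + 1)) ^ k)"
  proof -
    have "(q ^ (k choose 2)) ^ 4 = q ^ (4 * (k choose 2))" "(q ^ (2 * m + 1)) ^ k = q ^ ((2 * m + 1) * k)"
      by (simp_all only: power_mult[symmetric] mult.commute)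
    then show ?thesis
      unfolding binom power_add[of q "m choose 2"] power_add[of q "4 * (k choose 2)"] by (simp only:)
  qed
  have tpow: "(- \<beta> * t) ^ (m + 2 * k) = (- \<beta> * t) ^ m * ((\<beta> * t) ^ 2) ^ k"
    by (simp add: power_add power_mult)
  have sign: "((-1) ^ k * q ^ (k choose 2)) powi 4 = (q ^ (k choose 2)) ^ 4"
  proof -
    have "((-1) ^ k * q ^ (k choose 2)) powi 4 = ((-1) ^ k * q ^ (k choose 2)) ^ 4"
      by simp
    also have "\<dots> = ((-1) ^ 4) ^ k * (q ^ (k choose 2)) ^ 4"
      unfolding power_mult_distrib power_mult[symmetric] by (simp add: mult.commute)
    finally show ?thesis by simp
  qed
  have exponent: "1 + int (length [\<gamma> * q ^ (m + 1), \<beta> * p ^ m, - (\<beta> * p ^ m), \<beta> * p ^ (m + 1), - (\<beta> * p ^ (m + 1))])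
          - int (length [\<beta> * inverse \<gamma>, \<beta> * q ^ m]) = 4" by simp
  have "expansion_term q t z \<beta> \<gamma> m k = (- \<beta> * t) ^ (m + 2 * k) * q ^ ((m + 2 * k) choose 2) / qpoch (\<beta> ^ 2) q (m + 2 * k) *
     (connection_coeff q \<beta> \<gamma> (m + k) k * (1 - \<gamma> * q ^ m)) * rogers_sum q z \<gamma> m"
    by (simp add: expansion_term_def)
  then show ?thesis
    unfolding coeff lower qpow tpow exponent sign qpochs_def list.map prod_list.Cons prod_list.Nil mult_1_right power_mult_distrib[of _ _ k]
    by (simp only: divide_inverse inverse_mult_distrib mult_ac)
qed

text \<open>Exponential bounds, instead of the uniform ones that the convergence of \<open>(a;q)_\<infinity>\<close> would give:
they are elementary, and good enough against the decay of \<open>q ^ (n choose 2)\<close>.\<close>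

lemma qpoch_norm_bounds:
  fixes K :: real
  assumes "norm q \<le> 1"
  shows qpoch_norm_le: "norm a \<le> 1 \<Longrightarrow> 2 \<le> K \<Longrightarrow> norm (qpoch a q n) \<le> K ^ n"
    and inverse_qpoch_norm_le: "norm a < 1 \<Longrightarrow> 1 / (1 - norm a) \<le> K \<Longrightarrow> norm (inverse (qpoch a q n)) \<le> K ^ n"
proof -
  have aq: "norm (a * q ^ j) \<le> norm a" for j
    using assms mult_left_mono[of "norm q ^ j" 1 "norm a"] by (simp add: norm_mult norm_power power_le_one)
  show "norm (qpoch a q n) \<le> K ^ n" if "norm a \<le> 1" "2 \<le> K"
  proof -
    have "norm (1 - a * q ^ j) \<le> K" for j
      using norm_triangle_ineq4[of 1 "a * q ^ j"] aq[of j] that by simp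
    then have "(\<Prod>j<n. norm (1 - a * q ^ j)) \<le> (\<Prod>j<n. K)"
      by (intro prod_mono) auto
    then show ?thesis by (simp add: qpoch_def prod_norm)
  qed
  show "norm (inverse (qpoch a q n)) \<le> K ^ n" if "norm a < 1" "1 / (1 - norm a) \<le> K"
  proof -
    have "norm (inverse (1 - a * q ^ j)) \<le> K" for j
    proof -
      have "1 - norm a \<le> norm (1 - a * q ^ j)"
        using norm_triangle_ineq2[of 1 "a * q ^ j"] aq[of j] by simp
      then have "inverse (norm (1 - a * q ^ j)) \<le> inverse (1 - norm a)"
        using that by (intro le_imp_inverse_le) auto
      then show ?thesis using that by (simp add: norm_inverse divide_inverse)
    qed
    then have "(\<Prod>j<n. norm (inverse (1 - a * q ^ j))) \<le> (\<Prod>j<n. K)"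
      by (intro prod_mono) auto
    then show ?thesis by (simp add: qpoch_def prod_norm prod_inversef[symmetric] o_def)
  qed
qed

text \<open>One constant \<open>K\<close> dominates the base of all exponential bounds. The binomial exponent is at least
\<open>(m choose 2) + (k choose 2)\<close>, so the bound is a product of a function of \<open>m\<close> and the same
function of \<open>k\<close>.\<close>

lemma expansion_term_bound:
  assumes q: "norm q < 1" and \<beta>: "norm \<beta> < 1" and \<gamma>: "norm \<gamma> < 1" and z: "norm z = 1"
  obtains K :: real where "\<And>m k. norm (expansion_term q t z \<beta> \<gamma> m k) \<le>
     K ^ 2 * (((K ^ 8) ^ m * norm q ^ (m choose 2)) * ((K ^ 8) ^ k * norm q ^ (k choose 2)))"
proof
  have \<beta>2: "norm (\<beta> ^ 2) < 1" using \<beta> by (simp add: norm_power power_less_one_iff abs_square_less_1)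
  define K where "K = 2 + 1 / (1 - norm q) + 1 / (1 - norm \<gamma>) + 1 / (1 - norm (\<beta> ^ 2)) + norm (- \<beta> * t)"
  have pos: "0 \<le> 1 / (1 - norm q)" "0 \<le> 1 / (1 - norm \<gamma>)" "0 \<le> 1 / (1 - norm (\<beta> ^ 2))" "0 \<le> norm (- \<beta> * t)"
    using q \<gamma> \<beta>2 by simp_all
  have K: "2 \<le> K" "1 / (1 - norm q) \<le> K" "1 / (1 - norm \<gamma>) \<le> K" "1 / (1 - norm (\<beta> ^ 2)) \<le> K" "norm (- \<beta> * t) \<le> K"
    using pos unfolding K_def by linarith+
  have q1: "norm q \<le> 1" using q by simp
  note [simp del] = norm_minus_cancel
  have up: "norm (qpoch a q n) \<le> K ^ n" if "norm a < 1" for a n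
    using qpoch_norm_le[OF q1] that K by simp
  have down: "norm (inverse (qpoch q q n)) \<le> K ^ n" "norm (inverse (qpoch \<gamma> q n)) \<le> K ^ n"
     "norm (inverse (qpoch (\<beta> ^ 2) q n)) \<le> K ^ n" for n
    using inverse_qpoch_norm_le[OF q1] q \<gamma> \<beta>2 K by simp_all
  have aq: "norm (a * q ^ j) \<le> norm a" for a j
    using q1 mult_left_mono[of "norm q ^ j" 1 "norm a"] by (simp add: norm_mult norm_power power_le_one)
  have R: "norm (rogers_sum q z \<gamma> m) \<le> K ^ (3 * m)" for m
  proof -
    have "norm (rogers_sum q z \<gamma> m) \<le> (\<Sum>k\<le>m. K ^ (2 * m))"
      unfolding rogers_sum_def
    proof (intro sum_norm_le)
      fix k assume "k \<in> {..m}"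
      have "norm (qpoch \<gamma> q k / qpoch q q k * z ^ k * (qpoch \<gamma> q (m - k) / qpoch q q (m - k) * inverse z ^ (m - k)))
         = (norm (qpoch \<gamma> q k) * norm (inverse (qpoch q q k))) * (norm (qpoch \<gamma> q (m - k)) * norm (inverse (qpoch q q (m - k))))"
        using z by (simp add: norm_mult norm_divide norm_power norm_inverse divide_inverse)
      also have "\<dots> \<le> (K ^ k * K ^ k) * (K ^ (m - k) * K ^ (m - k))"
        using K by (intro mult_mono up down \<gamma> mult_nonneg_nonneg) auto
      also have "\<dots> = K ^ (2 * m)"
        using \<open>k \<in> {..m}\<close> by (simp add: mult_2 flip: power_add)
      finally show "norm (qpoch \<gamma> q k / qpoch q q k * z ^ k * (qpoch \<gamma> q (m - k) / qpoch q q (m - k) * inverse z ^ (m - k))) \<le> K ^ (2 * m)" .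
    qed
    also have "\<dots> = real (m + 1) * K ^ (2 * m)" by simp
    also have "real (m + 1) \<le> K ^ m"
    proof -
      have "real (m + 1) \<le> 2 ^ m"
        using of_nat_mono[of "m + 1" "2 ^ m", where ?'a = real] by (simp add: Suc_leI)
      also have "(2::real) ^ m \<le> K ^ m" using K by (intro power_mono) auto
      finally show ?thesis .
    qed
    then have "real (m + 1) * K ^ (2 * m) \<le> K ^ m * K ^ (2 * m)"
      using K by (intro mult_right_mono) auto
    also have "\<dots> = K ^ (3 * m)" by (simp flip: power_add)
    finally show ?thesis .
  qed
  have P: "norm (\<Prod>j<k. \<gamma> - \<beta> * q ^ j) \<le> K ^ k" for k
  proof -
    have "norm (\<gamma> - \<beta> * q ^ j) \<le> K" for j
      using norm_triangle_ineq4[of \<gamma> "\<beta> * q ^ j"] aq[of \<beta> j] \<beta> \<gamma> K(1) by simp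
    then have "(\<Prod>j<k. norm (\<gamma> - \<beta> * q ^ j)) \<le> (\<Prod>j<k. K)"
      by (intro prod_mono) auto
    then show ?thesis by (simp add: prod_norm)
  qed
  fix m k
  have C: "norm (connection_coeff q \<beta> \<gamma> (m + k) k) \<le> (K ^ k * K ^ (m + k)) * (K ^ k * K ^ (m + k + 1))"
  proof -
    have "norm (connection_coeff q \<beta> \<gamma> (m + k) k) =
      (norm (\<Prod>j<k. \<gamma> - \<beta> * q ^ j) * norm (qpoch \<beta> q (m + k))) *
      (norm (inverse (qpoch q q k)) * norm (inverse (qpoch \<gamma> q (m + k + 1))))"
      by (simp add: connection_coeff_def norm_mult norm_divide norm_inverse divide_inverse)
    also have "\<dots> \<le> (K ^ k * K ^ (m + k)) * (K ^ k * K ^ (m + k + 1))"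
      using K by (intro mult_mono P up down \<beta> mult_nonneg_nonneg) auto
    finally show ?thesis .
  qed
  have one: "norm (1 - \<gamma> * q ^ m) \<le> K"
    using norm_triangle_ineq4[of 1 "\<gamma> * q ^ m"] aq[of \<gamma> m] \<gamma> K(1) by simp
  have T: "norm ((- \<beta> * t) ^ (m + 2 * k)) \<le> K ^ (m + 2 * k)"
    unfolding norm_power using K by (intro power_mono) auto
  have Q: "norm (q ^ ((m + 2 * k) choose 2)) \<le> norm q ^ ((m choose 2) + (k choose 2))"
    unfolding norm_power using q1
    by (intro power_decreasing) (auto simp: choose2_add choose2_double)
  have "norm (expansion_term q t z \<beta> \<gamma> m k) =
     norm ((- \<beta> * t) ^ (m + 2 * k)) * norm (q ^ ((m + 2 * k) choose 2)) * norm (inverse (qpoch (\<beta> ^ 2) q (m + 2 * k))) *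
     (norm (connection_coeff q \<beta> \<gamma> (m + k) k) * (norm (1 - \<gamma> * q ^ m) * norm (rogers_sum q z \<gamma> m)))"
    unfolding expansion_term_def divide_inverse norm_mult ..
  also have "\<dots> \<le> K ^ (m + 2 * k) * norm q ^ ((m choose 2) + (k choose 2)) * K ^ (m + 2 * k) *
     (((K ^ k * K ^ (m + k)) * (K ^ k * K ^ (m + k + 1))) * (K * K ^ (3 * m)))"
    using K by (intro mult_mono T Q down C one R mult_nonneg_nonneg) auto
  also have "\<dots> = K ^ (7 * m + 8 * k + 2) * norm q ^ ((m choose 2) + (k choose 2))"
  proof -
    have "K ^ (m + 2 * k) * K ^ (m + 2 * k) * (((K ^ k * K ^ (m + k)) * (K ^ k * K ^ (m + k + 1))) * (K ^ 1 * K ^ (3 * m)))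
       = K ^ (7 * m + 8 * k + 2)"
      unfolding power_add[symmetric] by (rule arg_cong[of _ _ "\<lambda>n. K ^ n"]) simp
    moreover have "x * w * y * u = n * w" if "x * y * u = n" for x y u w n :: real
      unfolding that[symmetric] by simp
    ultimately show ?thesis unfolding power_one_right by blast
  qed
  also have "\<dots> \<le> K ^ (8 * m + 8 * k + 2) * norm q ^ ((m choose 2) + (k choose 2))"
    using K by (intro mult_right_mono power_increasing) auto
  also have "\<dots> = K ^ 2 * (((K ^ 8) ^ m * norm q ^ (m choose 2)) * ((K ^ 8) ^ k * norm q ^ (k choose 2)))"
    unfolding power_add power_mult by (simp only: mult_ac)
  finally show "norm (expansion_term q t z \<beta> \<gamma> m k) \<le>
     K ^ 2 * (((K ^ 8) ^ m * norm q ^ (m choose 2)) * ((K ^ 8) ^ k * norm q ^ (k choose 2)))" .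
qed

lemma expansion_term_summable:
  assumes q: "norm q < 1" and \<beta>: "norm \<beta> < 1" and \<gamma>: "norm \<gamma> < 1" and z: "norm z = 1"
  shows "(\<lambda>(m, k). expansion_term q t z \<beta> \<gamma> m k) summable_on UNIV"
proof -
  obtain K :: real where K: "\<And>m k. norm (expansion_term q t z \<beta> \<gamma> m k) \<le>
     K ^ 2 * (((K ^ 8) ^ m * norm q ^ (m choose 2)) * ((K ^ 8) ^ k * norm q ^ (k choose 2)))"
    using expansion_term_bound[OF assms] by blast
  define g where "g n = (K ^ 8) ^ n * norm q ^ (n choose 2)" for n
  have g: "g summable_on UNIV"
    unfolding g_def using q by (intro norm_summable_imp_summable_on summable_gaussian) auto
  have g_pos: "0 \<le> g n" for n by (simp add: g_def)
  have "(\<lambda>(m, k). K ^ 2 * (g m * g k)) summable_on (UNIV \<times> UNIV)"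
  proof (rule summable_on_SigmaI)
    show "((\<lambda>k. (case (m, k) of (m, k) \<Rightarrow> K ^ 2 * (g m * g k))) has_sum (K ^ 2 * (g m * infsum g UNIV))) UNIV" for m
      using g by (auto intro!: has_sum_cmult_right)
    show "(\<lambda>m. K ^ 2 * (g m * infsum g UNIV)) summable_on UNIV"
      using g by (intro summable_on_cmult_right summable_on_cmult_left)
  qed (use g_pos in auto)
  then have "(\<lambda>(m, k). K ^ 2 * (g m * g k)) summable_on UNIV"
    unfolding UNIV_Times_UNIV .
  then have "(\<lambda>x. norm (case x of (m, k) \<Rightarrow> expansion_term q t z \<beta> \<gamma> m k)) summable_on UNIV"
    by (intro Infinite_Sum.abs_summable_on_comparison_test'[of "\<lambda>(m, k). K ^ 2 * (g m * g k)"])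
       (auto simp: g_def K)
  then show ?thesis by (rule Infinite_Sum.abs_summable_summable)
qed

text \<open>The case \<open>\<gamma> = \<beta>\<close> of the expansion, where the \<open>2\<phi>5\<close> collapses to 1: a generating function of the
Rogers polynomials.\<close>

lemma rogers_generating_function:
  assumes q: "norm q < 1" and \<beta>: "norm \<beta> < 1" and z: "norm z = 1" and t: "norm t < 1"
  shows "(\<lambda>n. (- \<beta> * t) ^ n * q ^ (n choose 2) / qpoch (\<beta> ^ 2) q n * rogers_sum q z \<beta> n) sums
    (qpoch_inf (t * inverse z) q * qhyp [\<beta>, \<beta> * z ^ 2] [\<beta> ^ 2] q (t * inverse z))"
proof -
  have \<beta>2: "norm (\<beta> ^ 2) < 1" using \<beta> by (simp add: norm_power power_less_one_iff abs_square_less_1)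
  have "z \<noteq> 0" using z by auto
  have "norm (t * inverse z) < 1" using z t by (simp add: norm_mult norm_inverse)
  note sums = qpoch_inf_times_2_1_sums[OF q \<beta>2 this, of "\<beta> * z ^ 2" \<beta>]
  have "(- (t * inverse z)) ^ n * q ^ (n choose 2) / qpoch (\<beta> ^ 2) q n *
         (\<Sum>k\<le>n. (\<beta> * z ^ 2) ^ k * qpoch \<beta> q k * (\<Prod>i<n-k. \<beta> - \<beta> ^ 2 * q ^ i) / (qpoch q q k * qpoch q q (n - k)))
     = (- \<beta> * t) ^ n * q ^ (n choose 2) / qpoch (\<beta> ^ 2) q n * rogers_sum q z \<beta> n" for n
    unfolding rogers_sum_def sum_distrib_left
  proof (intro sum.cong refl)
    fix k assume "k \<in> {..n}"
    then obtain l where n: "n = k + l" by (metis atMost_iff le_iff_add)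
    have prod: "(\<Prod>i<l. \<beta> - \<beta> ^ 2 * q ^ i) = \<beta> ^ l * qpoch \<beta> q l"
    proof -
      have "\<beta> - \<beta> ^ 2 * q ^ i = \<beta> * (1 - \<beta> * q ^ i)" for i
        by (simp add: algebra_simps power2_eq_square)
      then show ?thesis by (simp add: qpoch_def prod.distrib)
    qed
    have "(- (t * inverse z)) ^ (k + l) * ((\<beta> * z ^ 2) ^ k * \<beta> ^ l) = (- (t * inverse z) * (\<beta> * z ^ 2)) ^ k * (- (t * inverse z) * \<beta>) ^ l"
      by (simp only: power_add power_mult_distrib mult_ac)
    also have "\<dots> = (- \<beta> * t * z) ^ k * (- \<beta> * t * inverse z) ^ l"
      using \<open>z \<noteq> 0\<close> by (simp add: power2_eq_square mult_ac)
    also have "\<dots> = (- \<beta> * t) ^ (k + l) * (z ^ k * inverse z ^ l)"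
      by (simp only: power_add power_mult_distrib mult_ac)
    finally have pow: "(- (t * inverse z)) ^ (k + l) * ((\<beta> * z ^ 2) ^ k * \<beta> ^ l) = (- \<beta> * t) ^ (k + l) * (z ^ k * inverse z ^ l)" .
    have "(- (t * inverse z)) ^ n * q ^ (n choose 2) / qpoch (\<beta> ^ 2) q n *
      ((\<beta> * z ^ 2) ^ k * qpoch \<beta> q k * (\<Prod>i<n-k. \<beta> - \<beta> ^ 2 * q ^ i) / (qpoch q q k * qpoch q q (n - k)))
      = ((- (t * inverse z)) ^ (k + l) * ((\<beta> * z ^ 2) ^ k * \<beta> ^ l)) * (q ^ (n choose 2) / qpoch (\<beta> ^ 2) q n *
        (qpoch \<beta> q k * qpoch \<beta> q l / (qpoch q q k * qpoch q q l)))"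
      unfolding n add_diff_cancel_left' prod by (simp add: mult_ac)
    then show "(- (t * inverse z)) ^ n * q ^ (n choose 2) / qpoch (\<beta> ^ 2) q n *
      ((\<beta> * z ^ 2) ^ k * qpoch \<beta> q k * (\<Prod>i<n-k. \<beta> - \<beta> ^ 2 * q ^ i) / (qpoch q q k * qpoch q q (n - k))) =
      (- \<beta> * t) ^ n * q ^ (n choose 2) / qpoch (\<beta> ^ 2) q n *
      ((qpoch \<beta> q k / qpoch q q k * z ^ k) * (qpoch \<beta> q (n - k) / qpoch q q (n - k) * inverse z ^ (n - k)))"
      unfolding pow by (simp add: n mult_ac)
  qed
  with sums show ?thesis by (simp only:)
qed

text \<open>Both sides are sums of the same absolutely convergent double series. Summed along \<open>m + 2 k = n\<close>, it
gives the generating function by the connection formula; summed over \<open>k\<close> for fixed \<open>m\<close>, it gives the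
\<open>2\<phi>5\<close> series.\<close>

lemma rogers_expansion:
  fixes q p t z \<beta> \<gamma> :: complex
  assumes q: "q \<noteq> 0" "norm q < 1" and p: "p ^ 2 = q" and \<beta>: "norm \<beta> < 1" and \<gamma>: "\<gamma> \<noteq> 0" "norm \<gamma> < 1"
    and z: "norm z = 1" and t: "norm t < 1"
  shows "(\<lambda>n. qpoch \<beta> q n * q ^ (n choose 2) * (- \<beta> * t) ^ n / qpochs [\<gamma>, \<beta> ^ 2] q n
              * rogers_sum q z \<gamma> n
              * qhyp [\<beta> * inverse \<gamma>, \<beta> * q ^ n]
                     [\<gamma> * q ^ (n + 1), \<beta> * p ^ n, - (\<beta> * p ^ n), \<beta> * p ^ (n + 1), - (\<beta> * p ^ (n + 1))]
                     q (\<gamma> * (\<beta> * t) ^ 2 * q ^ (2 * n + 1)))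
         sums (qpoch_inf (t * inverse z) q * qhyp [\<beta>, \<beta> * z ^ 2] [\<beta> ^ 2] q (t * inverse z))"
    (is "?f sums ?S")
proof -
  let ?F = "expansion_term q t z \<beta> \<gamma>"
  have "z \<noteq> 0" using z by auto
  obtain S where S: "((\<lambda>(m, k). ?F m k) has_sum S) UNIV"
    using expansion_term_summable[OF q(2) \<beta> \<gamma>(2) z] by (auto simp: summable_on_def)
  have "((\<lambda>(m, k). ?F m k) has_sum S) UNIV \<longleftrightarrow>
      ((\<lambda>(n, k). ?F (n - 2 * k) k) has_sum S) (Sigma UNIV (\<lambda>n. {..n div 2}))"
    by (rule has_sum_reindex_bij_witness[where j = "\<lambda>(m, k). (m + 2 * k, k)" and i = "\<lambda>(n, k). (n - 2 * k, k)"]) auto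
  with S have "((\<lambda>(n, k). ?F (n - 2 * k) k) has_sum S) (Sigma UNIV (\<lambda>n. {..n div 2}))"
    by blast
  then have "((\<lambda>n. \<Sum>k\<le>n div 2. ?F (n - 2 * k) k) has_sum S) UNIV"
    by (rule has_sum_SigmaD) auto
  then have "(\<lambda>n. \<Sum>k\<le>n div 2. ?F (n - 2 * k) k) sums S"
    by (rule has_sum_imp_sums)
  moreover have "(\<Sum>k\<le>n div 2. ?F (n - 2 * k) k) =
     (- \<beta> * t) ^ n * q ^ (n choose 2) / qpoch (\<beta> ^ 2) q n * rogers_sum q z \<beta> n" for n
    unfolding rogers_connection[OF q \<gamma>(2) \<open>z \<noteq> 0\<close>, of \<beta> n] sum_distrib_left
  proof (intro sum.cong refl)
    fix k assume "k \<in> {..n div 2}"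
    then have "n - 2 * k + 2 * k = n" "n - 2 * k + k = n - k" by auto
    then show "?F (n - 2 * k) k = (- \<beta> * t) ^ n * q ^ (n choose 2) / qpoch (\<beta> ^ 2) q n *
      (connection_coeff q \<beta> \<gamma> (n - k) k * ((1 - \<gamma> * q ^ (n - 2 * k)) * rogers_sum q z \<gamma> (n - 2 * k)))"
      by (simp only: expansion_term_def)
  qed
  ultimately have "S = ?S"
    using rogers_generating_function[OF q(2) \<beta> z t] sums_unique2 by fastforce
  have "((\<lambda>(m, k). ?F m k) has_sum S) (Sigma UNIV (\<lambda>_. UNIV))" using S by simp
  then have "(?f has_sum S) UNIV"
  proof (rule has_sum_SigmaD)
    fix m
    have "(\<lambda>k. ?F m k) summable_on UNIV"
      using summable_on_SigmaD1[of "\<lambda>m k. ?F m k" UNIV "\<lambda>_. UNIV" m]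
        expansion_term_summable[OF q(2) \<beta> \<gamma>(2) z] by simp
    then have sum: "((\<lambda>k. ?F m k) has_sum (\<Sum>\<^sub>\<infinity>k. ?F m k)) UNIV" by simp
    then have sums: "(\<lambda>k. ?F m k) sums (\<Sum>\<^sub>\<infinity>k. ?F m k)" by (rule has_sum_imp_sums)
    have "(\<Sum>\<^sub>\<infinity>k. ?F m k) = ?f m"
    proof -
      define c where "c = qpoch \<beta> q m * q ^ (m choose 2) * (- \<beta> * t) ^ m / qpochs [\<gamma>, \<beta> ^ 2] q m * rogers_sum q z \<gamma> m"
      note F = expansion_term_eq_2phi5_term[OF q(2) p \<gamma>(2,1), of t z \<beta> m, folded c_def]
      have eq: "?f m = c * qhyp [\<beta> * inverse \<gamma>, \<beta> * q ^ m]
                   [\<gamma> * q ^ (m + 1), \<beta> * p ^ m, - (\<beta> * p ^ m), \<beta> * p ^ (m + 1), - (\<beta> * p ^ (m + 1))]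
                   q (\<gamma> * (\<beta> * t) ^ 2 * q ^ (2 * m + 1))"
          by (simp only: c_def)
      show ?thesis
      \<comment> \<open>if \<open>c = 0\<close>, the convergence of the \<open>2\<phi>5\<close> cannot be read off from that of its multiple\<close>
      proof (cases "c = 0")
        case True
        then show ?thesis unfolding eq using F by simp
      next
        case False
        have summable: "summable (\<lambda>k. ?F m k)" using sums by (rule sums_summable)
        have "(\<Sum>\<^sub>\<infinity>k. ?F m k) = (\<Sum>k. ?F m k)"
          by (rule sums_unique[OF sums])
        also have "\<dots> = ?f m"
          unfolding eq unfolding qhyp_def F
          by (rule suminf_mult, rule summable_mult_D[OF summable[unfolded F] False])
        finally show ?thesis .
      qed
    qed
    then show "((\<lambda>k. case (m, k) of (m, k) \<Rightarrow> ?F m k) has_sum ?f m) UNIV"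
      using sum by simp
  qed
  then show ?thesis
    unfolding \<open>S = ?S\<close> by (rule has_sum_imp_sums)
qed

theorem theorem3:
  fixes q p t :: complex and x \<theta> \<beta> \<gamma> :: real
  assumes "0 < norm q" and "norm q < 1"
    and "p ^ 2 = q"
    and "0 \<le> \<theta>" and "\<theta> \<le> pi" and "x = cos \<theta>"
    and "\<beta> \<in> {-1<..<1} - {0}" and "\<gamma> \<in> {-1<..<1} - {0}"
    and "norm t < 1 - \<beta> ^ 2"
  shows "(\<lambda>n. qpoch \<beta> q n * q ^ (n choose 2) * (- of_real \<beta> * t) ^ n / qpochs [of_real \<gamma>, of_real \<beta> ^ 2] q n
              * rogers n x \<gamma> q
              * qhyp [of_real \<beta> * inverse (of_real \<gamma>), \<beta> * q ^ n]
                     [\<gamma> * q ^ (n + 1), \<beta> * p ^ n, - (\<beta> * p ^ n),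
                      \<beta> * p ^ (n + 1), - (\<beta> * p ^ (n + 1))]
                     q (\<gamma> * (\<beta> * t) ^ 2 * q ^ (2 * n + 1)))
         sums
         (qpoch_inf (t * exp (- \<i> * \<theta>)) q
          * qhyp [\<beta>, \<beta> * exp (2 * \<i> * \<theta>)] [of_real \<beta> ^ 2] q (t * exp (- \<i> * \<theta>)))"
proof -
  define z where "z = exp (\<i> * complex_of_real \<theta>)"
  have q: "q \<noteq> 0" "norm q < 1" using assms(1,2) by auto
  have \<beta>: "norm (complex_of_real \<beta>) < 1" and \<gamma>: "complex_of_real \<gamma> \<noteq> 0" "norm (complex_of_real \<gamma>) < 1"
    using assms(7,8) by auto
  have z: "norm z = 1" by (simp add: z_def)
  have t: "norm t < 1"
    using assms(9) zero_le_power2[of \<beta>] by linarith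
  have zi: "exp (- \<i> * complex_of_real \<theta>) = inverse z"
    by (simp add: z_def exp_minus)
  have z2: "exp (2 * \<i> * complex_of_real \<theta>) = z ^ 2"
    by (simp add: z_def exp_double[symmetric] mult.assoc)
  have R: "rogers n x \<gamma> q = rogers_sum q z \<gamma> n" for n
    unfolding assms(6) z_def by (rule rogers_eq_rogers_sum[OF q \<gamma> assms(4,5)])
  show ?thesis
    unfolding zi z2 R by (rule rogers_expansion[OF q assms(3) \<beta> \<gamma> z t])
qed

end
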